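(* Suppose that $\mathbb{E}(\|Z\|^2) < \infty$ and $\mu := \mathbb{E} Z \neq \mathbf{0}$. Then $\lim_{n\to\infty} n^{-1}\operatorname{Var} D_n = \sigma^2_\mu$. Moreover, if $\sigma^2_\mu > 0$, then for $\zeta\sim\mathcal{N}(0,1)$, as $n\to\infty$, \[ \frac{D_n - \mathbb{E} D_n}{\sqrt{\operatorname{Var} D_n}} \overset{d}{\longrightarrow} \zeta, \quad\text{and}\quad \frac{D_n - n\|\mu\|}{\sqrt{n\sigma^2_\mu}} \overset{d}{\longrightarrow} \zeta. \]
   Context: Let $Z, Z_1, Z_2, \ldots$ be i.i.d. random variables in $\mathbb{R}^2$, and let $S_0 := \mathbf{0}$ (the origin) and $S_n := \sum_{k=1}^n Z_k$ for $n \ge 1$. Let $D_n := \operatorname{diam}\{S_0, \ldots, S_n\} = \max_{0\le i,j\le n}\|S_j - S_i\|$. Here $\|\cdot\|$ is the Euclidean norm, $\mathcal{N}(0,1)$ is the standard normal distribution, and $\overset{d}{\longrightarrow}$ denotes convergence in distribution. With $\hat\mu := \mu/\|\mu\|$, define $\sigma^2_\mu := \mathbb{E}[((Z-\mu)\cdot\hat\mu)^2]$. *)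

theory Defs
  imports "HOL-Probability.Probability"
begin

text \<open>
  The increments are \<open>Z 1, Z 2, \<dots>\<close>; the index \<open>0\<close> is not a step of the walk and is
  free for the generic copy of the increment distribution.
\<close>

definition walk :: "(nat \<Rightarrow> 'a \<Rightarrow> 'v::real_normed_vector) \<Rightarrow> nat \<Rightarrow> 'a \<Rightarrow> 'v" where
  "walk Z n \<omega> = (\<Sum>k=1..n. Z k \<omega>)"

definition walk_diameter :: "(nat \<Rightarrow> 'a \<Rightarrow> 'v::real_normed_vector) \<Rightarrow> nat \<Rightarrow> 'a \<Rightarrow> real" where
  "walk_diameter Z n \<omega> = diameter ((\<lambda>i. walk Z i \<omega>) ` {0..n})"

text \<open>
  The number \<open>\<sigma>\<^sup>2\<^sub>\<mu> = E[((X - \<mu>) \<bullet> \<mu>/\<parallel>\<mu>\<parallel>)\<^sup>2]\<close> with \<open>\<mu> = E X\<close>; meaningful only for \<open>\<mu> \<noteq> 0\<close>.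
\<close>

definition drift_variance :: "'a measure \<Rightarrow> ('a \<Rightarrow> 'v::euclidean_space) \<Rightarrow> real" where
  "drift_variance M X =
     (let \<mu> = prob_space.expectation M X; \<mu>hat = \<mu> /\<^sub>R norm \<mu>
      in prob_space.expectation M (\<lambda>\<omega>. ((X \<omega> - \<mu>) \<bullet> \<mu>hat)\<^sup>2))"

end

theory Submission
  imports Defs
begin

text \<open>
  Let \<open>S\<^sub>n\<close> be the walk, \<open>m = \<parallel>\<mu>\<parallel>\<close>, and let \<open>T\<^sub>n = S\<^sub>n \<bullet> \<mu>/m\<close> be its projection on the drift direction,
  a sum of independent real steps with mean \<open>m\<close> and variance \<open>\<sigma>\<^sup>2\<close>. The diameter is almost attained
  between the first and the last point of the walk, and almost in the drift direction: the
  remainder \<open>R\<^sub>n = D\<^sub>n - T\<^sub>n\<close>, which is never negative, satisfies \<open>E R\<^sub>n\<^sup>2 = o(n)\<close>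
  (\<open>remainder_second_moment_small\<close>). The variance asymptotics and the normal limit of \<open>T\<^sub>n\<close> therefore
  carry over to \<open>D\<^sub>n\<close>: for the variance by the Cauchy-Schwarz inequality (\<open>variance_limit\<close>), for the
  limit in distribution by closeness in \<open>L\<^sup>1\<close> (\<open>weak_conv_of_L1_close\<close>).

  The remainder is estimated path by path (\<open>drifting_path_extent_le\<close>). Fix a large constant \<open>K\<close>
  and call fluctuations (deviations of the walk from its mean) typical if they are smaller than
  \<open>K \<surd>n\<close>. After \<open>O(\<surd>n)\<close> steps the drift outweighs typical fluctuations, so up to atypical ones the
  projected path can fall below \<open>T\<^sub>0 = 0\<close> only near its start, and exceed \<open>T\<^sub>n\<close> only near its end; both
  stretches are so short that their fluctuations have second moment \<open>O(\<surd>n)\<close>. Typical transversal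
  displacements of order \<open>\<surd>n\<close> lengthen a segment of length of order \<open>n\<close> only by \<open>O(1)\<close>.

  It remains to see that atypical fluctuations are negligible when just two moments are finite.
  The maximum over \<open>k \<le> n\<close> of the part of the \<open>k\<close>-th fluctuation beyond \<open>K \<surd>n\<close> is controlled by its value at
  time \<open>n\<close>, by Doob's inequality for the submartingale of these parts (\<open>maximal_inequality\<close>); and
  at time \<open>n\<close> its second moment is at most \<open>\<epsilon> n\<close> for suitable \<open>K\<close>, because the central limit theorem
  together with the convergence of second moments yields uniform integrability
  (\<open>excess_S_small\<close>).
\<close>

section \<open>Square-integrable random variables\<close>

definition square_integrable :: "'a measure \<Rightarrow> ('a \<Rightarrow> real) \<Rightarrow> bool" where
  "square_integrable M f \<longleftrightarrow> f \<in> borel_measurable M \<and> integrable M (\<lambda>\<omega>. (f \<omega>)\<^sup>2)"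

lemma square_integrable_measurable: "square_integrable M f \<Longrightarrow> f \<in> borel_measurable M"
  by (simp add: square_integrable_def)

lemma square_integrable_power2: "square_integrable M f \<Longrightarrow> integrable M (\<lambda>\<omega>. (f \<omega>)\<^sup>2)"
  by (simp add: square_integrable_def)

lemma square_integrable_bound:
  assumes "square_integrable M g" "f \<in> borel_measurable M"
    and "\<And>\<omega>. \<omega> \<in> space M \<Longrightarrow> \<bar>f \<omega>\<bar> \<le> \<bar>g \<omega>\<bar>"
  shows "square_integrable M f"
  unfolding square_integrable_def
proof
  show "integrable M (\<lambda>\<omega>. (f \<omega>)\<^sup>2)"
    using assms
    by (intro Bochner_Integration.integrable_bound[OF square_integrable_power2[OF assms(1)]] AE_I2)
       (auto simp: abs_le_square_iff)
qed fact

lemma square_integrable_mult: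
  assumes "square_integrable M f" "square_integrable M g"
  shows "integrable M (\<lambda>\<omega>. f \<omega> * g \<omega>)"
proof (rule Bochner_Integration.integrable_bound)
  show "integrable M (\<lambda>\<omega>. (f \<omega>)\<^sup>2 + (g \<omega>)\<^sup>2)"
    using assms by (simp add: square_integrable_def)
  show "(\<lambda>\<omega>. f \<omega> * g \<omega>) \<in> borel_measurable M"
    using assms by (intro borel_measurable_times square_integrable_measurable)
  have "\<bar>a * b\<bar> \<le> a\<^sup>2 + b\<^sup>2" for a b :: real
  proof -
    have "2 * (\<bar>a\<bar> * \<bar>b\<bar>) \<le> a\<^sup>2 + b\<^sup>2"
      using sum_squares_bound[of "\<bar>a\<bar>" "\<bar>b\<bar>"] by (simp add: mult.assoc)
    moreover have "0 \<le> \<bar>a\<bar> * \<bar>b\<bar>" by simp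
    ultimately show ?thesis unfolding abs_mult by linarith
  qed
  then show "AE \<omega> in M. norm (f \<omega> * g \<omega>) \<le> norm ((f \<omega>)\<^sup>2 + (g \<omega>)\<^sup>2)"
    by simp
qed

lemma square_integrable_add:
  assumes "square_integrable M f" "square_integrable M g"
  shows "square_integrable M (\<lambda>\<omega>. f \<omega> + g \<omega>)"
proof -
  have "integrable M (\<lambda>\<omega>. (f \<omega>)\<^sup>2 + (g \<omega>)\<^sup>2 + 2 * (f \<omega> * g \<omega>))"
    using assms square_integrable_mult[OF assms]
    by (intro Bochner_Integration.integrable_add integrable_mult_right square_integrable_power2) auto
  then show ?thesis
    using assms by (simp add: square_integrable_def power2_sum mult.assoc borel_measurable_add)
qed

lemma square_integrable_cmult:
  "square_integrable M f \<Longrightarrow> square_integrable M (\<lambda>\<omega>. c * f \<omega>)"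
  by (simp add: square_integrable_def power_mult_distrib borel_measurable_times)

lemma square_integrable_diff:
  "square_integrable M f \<Longrightarrow> square_integrable M g \<Longrightarrow> square_integrable M (\<lambda>\<omega>. f \<omega> - g \<omega>)"
  using square_integrable_add[of M f "\<lambda>\<omega>. -1 * g \<omega>"] square_integrable_cmult[of M g "-1"] by simp

lemma square_integrable_sum:
  "(\<And>i. i \<in> I \<Longrightarrow> square_integrable M (f i)) \<Longrightarrow> square_integrable M (\<lambda>\<omega>. \<Sum>i\<in>I. f i \<omega>)"
proof (induction I rule: infinite_finite_induct)
  case (insert i I)
  then show ?case by (simp add: square_integrable_add)
qed (simp_all add: square_integrable_def)

lemma square_integrable_abs:
  "square_integrable M f \<Longrightarrow> square_integrable M (\<lambda>\<omega>. \<bar>f \<omega>\<bar>)"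
  by (simp add: square_integrable_def borel_measurable_abs)

context prob_space
begin

lemma square_integrable_const: "square_integrable M (\<lambda>_. c)"
  by (simp add: square_integrable_def)

lemma square_integrable_integrable: "square_integrable M f \<Longrightarrow> integrable M f"
  by (auto simp: square_integrable_def intro: square_integrable_imp_integrable)

lemma expectation_abs_le_sqrt:
  assumes "square_integrable M f"
  shows "expectation (\<lambda>\<omega>. \<bar>f \<omega>\<bar>) \<le> sqrt (expectation (\<lambda>\<omega>. (f \<omega>)\<^sup>2))"
proof (rule real_le_rsqrt)
  have "variance (\<lambda>\<omega>. \<bar>f \<omega>\<bar>) = expectation (\<lambda>\<omega>. (f \<omega>)\<^sup>2) - (expectation (\<lambda>\<omega>. \<bar>f \<omega>\<bar>))\<^sup>2"
    using assms by (subst variance_eq)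
      (auto intro: square_integrable_integrable square_integrable_abs square_integrable_power2)
  with variance_positive[of "\<lambda>\<omega>. \<bar>f \<omega>\<bar>"]
  show "(expectation (\<lambda>\<omega>. \<bar>f \<omega>\<bar>))\<^sup>2 \<le> expectation (\<lambda>\<omega>. (f \<omega>)\<^sup>2)" by linarith
qed

text \<open>
  The Cauchy-Schwarz inequality: the expectation of the square of \<open>s f + t g\<close> is a
  quadratic form in \<open>(s, t)\<close> which is never negative, so its discriminant is not positive.
\<close>
lemma expectation_cauchy_schwarz:
  assumes f: "square_integrable M f" and g: "square_integrable M g"
  shows "\<bar>expectation (\<lambda>\<omega>. f \<omega> * g \<omega>)\<bar>
    \<le> sqrt (expectation (\<lambda>\<omega>. (f \<omega>)\<^sup>2)) * sqrt (expectation (\<lambda>\<omega>. (g \<omega>)\<^sup>2))"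
proof -
  define a where "a = expectation (\<lambda>\<omega>. (f \<omega>)\<^sup>2)"
  define b where "b = expectation (\<lambda>\<omega>. (g \<omega>)\<^sup>2)"
  define c where "c = expectation (\<lambda>\<omega>. f \<omega> * g \<omega>)"
  have int: "integrable M (\<lambda>\<omega>. (f \<omega>)\<^sup>2)" "integrable M (\<lambda>\<omega>. (g \<omega>)\<^sup>2)" "integrable M (\<lambda>\<omega>. f \<omega> * g \<omega>)"
    using f g by (auto intro: square_integrable_power2 square_integrable_mult)
  have quad: "0 \<le> s\<^sup>2 * a + t\<^sup>2 * b + 2 * s * t * c" for s t
  proof -
    have "0 \<le> expectation (\<lambda>\<omega>. (s * f \<omega> + t * g \<omega>)\<^sup>2)" by simp
    also have "(\<lambda>\<omega>. (s * f \<omega> + t * g \<omega>)\<^sup>2)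
      = (\<lambda>\<omega>. s\<^sup>2 * (f \<omega>)\<^sup>2 + t\<^sup>2 * (g \<omega>)\<^sup>2 + 2 * s * t * (f \<omega> * g \<omega>))"
      by (auto simp: power2_eq_square algebra_simps)
    also have "expectation \<dots> = s\<^sup>2 * a + t\<^sup>2 * b + 2 * s * t * c"
      using int by (simp add: a_def b_def c_def)
    finally show ?thesis .
  qed
  have ab: "0 \<le> a" "0 \<le> b" by (simp_all add: a_def b_def)
  have "c\<^sup>2 \<le> a * b"
  proof (cases "b = 0")
    case True
    show ?thesis
    proof (rule ccontr)
      assume "\<not> ?thesis"
      then have c: "c \<noteq> 0" using True by auto
      \<comment> \<open>This value of \<open>t\<close> makes the form, linear in \<open>t\<close> when \<open>b = 0\<close>, equal to \<open>-1\<close>.\<close>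
      have "0 \<le> a + 2 * (- (a + 1) / (2 * c)) * c"
        using quad[of 1 "- (a + 1) / (2 * c)"] True by simp
      also have "\<dots> = -1" using c by (simp add: field_simps)
      finally show False by simp
    qed
  next
    case False
    then have b: "b > 0" using ab by simp
    have "0 \<le> b\<^sup>2 * a + c\<^sup>2 * b + 2 * b * (- c) * c" using quad[of b "- c"] by simp
    also have "\<dots> = b * (a * b - c\<^sup>2)" by (simp add: power2_eq_square algebra_simps)
    finally show ?thesis using b by (simp add: zero_le_mult_iff)
  qed
  then have "\<bar>c\<bar> \<le> sqrt (a * b)" using real_le_rsqrt[of "\<bar>c\<bar>"] by simp
  then show ?thesis by (simp add: real_sqrt_mult a_def b_def c_def)
qed

lemma indep_vars_reindex:
  assumes ind: "indep_vars M' X UNIV" and f: "inj f"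
  shows "indep_vars (\<lambda>i. M' (f i)) (\<lambda>i. X (f i)) UNIV"
  unfolding indep_vars_def2
proof
  show "\<forall>i\<in>UNIV. random_variable (M' (f i)) (X (f i))"
    using ind by (simp add: indep_vars_def2)
  let ?F = "\<lambda>i. {X i -` A \<inter> space M |A. A \<in> sets (M' i)}"
  have F: "indep_sets ?F UNIV" using ind by (simp add: indep_vars_def2)
  show "indep_sets (\<lambda>i. ?F (f i)) UNIV"
  proof (rule indep_setsI)
    show "?F (f i) \<subseteq> events" for i using F by (simp add: indep_sets_def)
    fix A J assume J: "J \<noteq> {}" "J \<subseteq> UNIV" "finite J" and A: "\<forall>j\<in>J. A j \<in> ?F (f j)"
    have "prob (\<Inter>j\<in>f ` J. A (inv f j)) = (\<Prod>j\<in>f ` J. prob (A (inv f j)))"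
      using J A f by (intro indep_setsD[OF F]) auto
    then show "prob (\<Inter>j\<in>J. A j) = (\<Prod>j\<in>J. prob (A j))"
      using f by (simp add: prod.reindex inj_on_subset[OF f])
  qed
qed

end

section \<open>Maximal inequality for centred walks\<close>

text \<open>
  The convex function \<open>s \<mapsto> (|s| - l)\<^sup>+\<close> does two jobs. At \<open>l = 0\<close> it is \<open>|s|\<close>. At \<open>l\<close> of the
  order \<open>\<surd>n\<close> it keeps only the part of the walk beyond its typical size, whose second moment
  is a small fraction of \<open>n\<close>.
\<close>

definition excess :: "real \<Rightarrow> real \<Rightarrow> real" where
  "excess l s = max 0 (\<bar>s\<bar> - l)"

lemma excess_nonneg: "0 \<le> excess l s" by (simp add: excess_def)
lemma abs_le_excess: "\<bar>s\<bar> \<le> l + excess l s" by (simp add: excess_def)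
lemma excess_le_abs: "0 \<le> l \<Longrightarrow> excess l s \<le> \<bar>s\<bar>" by (simp add: excess_def)

lemma excess_measurable[measurable]: "excess l \<in> borel_measurable borel"
  unfolding excess_def by measurable

lemma excess_antimono: "l \<le> l' \<Longrightarrow> excess l' s \<le> excess l s"
  by (simp add: excess_def)

lemma excess_scale: "0 < c \<Longrightarrow> excess (c * l) (c * s) = c * excess l s"
  by (simp add: excess_def abs_mult max_def right_diff_distrib)

lemma excess_square_le: "0 \<le> l \<Longrightarrow> (excess l s)\<^sup>2 \<le> s\<^sup>2 - min (s\<^sup>2) (l\<^sup>2)"
proof (cases "\<bar>s\<bar> \<le> l")
  case False
  assume "0 \<le> l"
  with False have "l * l \<le> l * \<bar>s\<bar>" "l\<^sup>2 \<le> s\<^sup>2"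
    by (auto intro: mult_left_mono simp: abs_le_square_iff[symmetric])
  moreover have "(\<bar>s\<bar> - l)\<^sup>2 = s\<^sup>2 - 2 * (l * \<bar>s\<bar>) + l\<^sup>2"
    by (simp add: power2_diff)
  moreover have "excess l s = \<bar>s\<bar> - l" using False by (simp add: excess_def)
  ultimately show ?thesis by (simp add: power2_eq_square)
qed (simp add: excess_def)

definition excess_slope :: "real \<Rightarrow> real \<Rightarrow> real" where
  "excess_slope l s = (if s > l then 1 else if s < - l then -1 else 0)"

lemma excess_slope_measurable[measurable]: "excess_slope l \<in> borel_measurable borel"
  unfolding excess_slope_def by measurable

lemma excess_subgradient: "0 \<le> l \<Longrightarrow> excess l s + excess_slope l s * x \<le> excess l (s + x)"
  by (auto simp: excess_def excess_slope_def)

text \<open>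
  A form of Doob's \<open>L\<^sup>2\<close> inequality that holds for every sequence. The sum on the right is a
  discrete stochastic integral of the running maximum: for a submartingale \<open>y\<close> with
  \<open>y \<ge> 0\<close> its expectation is not negative, so that only the term \<open>4 (y n)\<^sup>2\<close> survives.
\<close>
lemma pathwise_maximal:
  fixes y :: "nat \<Rightarrow> real"
  shows "(Max (y ` {..n}))\<^sup>2
    \<le> 4 * (y n)\<^sup>2 - 4 * (\<Sum>k<n. Max (y ` {..k}) * (y (Suc k) - y k))"
proof -
  define a where "a k = Max (y ` {..k})" for k
  have strong: "(a n)\<^sup>2 \<le> 2 * a n * y n - 2 * (\<Sum>k<n. a k * (y (Suc k) - y k))"
  proof (induction n)
    case 0
    then show ?case by (simp add: a_def power2_eq_square)
  next
    case (Suc n)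
    have "a (Suc n) = max (y (Suc n)) (a n)"
      by (simp add: a_def atMost_Suc)
    \<comment> \<open>Either the maximum does not move, or it moves to the new value itself.\<close>
    then have "a (Suc n) = a n \<or> a (Suc n) = y (Suc n)" by (simp add: max_def)
    then have "(a (Suc n))\<^sup>2 - 2 * a (Suc n) * y (Suc n) \<le> (a n)\<^sup>2 - 2 * a n * y (Suc n)"
    proof
      assume "a (Suc n) = y (Suc n)"
      moreover have "0 \<le> (a n - y (Suc n))\<^sup>2" by simp
      ultimately show ?thesis by (simp add: power2_eq_square algebra_simps)
    qed simp
    with Suc show ?case by (simp add: algebra_simps)
  qed
  \<comment> \<open>Absorb the product \<open>2 a y\<close> into half of \<open>a\<^sup>2\<close>.\<close>
  have "0 \<le> (a n - 2 * y n)\<^sup>2" by simp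
  then have "4 * a n * y n \<le> (a n)\<^sup>2 + 4 * (y n)\<^sup>2" by (simp add: power2_eq_square algebra_simps)
  with strong show ?thesis unfolding a_def by linarith
qed

locale centered_walk = prob_space M for M :: "'a measure" +
  fixes x :: "nat \<Rightarrow> 'a \<Rightarrow> real"
  assumes indep: "indep_vars (\<lambda>_. borel) x UNIV"
    and sq_int: "\<And>i. square_integrable M (x i)"
    and centered: "\<And>i. expectation (x i) = 0"
begin

definition S :: "nat \<Rightarrow> 'a \<Rightarrow> real" where "S n \<omega> = (\<Sum>i<n. x i \<omega>)"

definition max_excess :: "real \<Rightarrow> nat \<Rightarrow> 'a \<Rightarrow> real" where
  "max_excess l n \<omega> = Max ((\<lambda>k. excess l (S k \<omega>)) ` {..n})"

lemma x_measurable[measurable]: "x i \<in> borel_measurable M"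
  using sq_int by (rule square_integrable_measurable)

lemma S_measurable[measurable]: "S n \<in> borel_measurable M"
  unfolding S_def by measurable

lemma S_square_integrable: "square_integrable M (S n)"
  unfolding S_def by (intro square_integrable_sum sq_int)

lemma S_Suc: "S (Suc n) \<omega> = S n \<omega> + x n \<omega>"
  by (simp add: S_def)

lemma max_excess_measurable[measurable]: "max_excess l n \<in> borel_measurable M"
  unfolding max_excess_def by measurable

lemma max_excess_ge: "k \<le> n \<Longrightarrow> excess l (S k \<omega>) \<le> max_excess l n \<omega>"
  unfolding max_excess_def by (intro Max_ge) auto

lemma max_excess_nonneg: "0 \<le> max_excess l n \<omega>"
  using max_excess_ge[of 0 n l \<omega>] excess_nonneg[of l "S 0 \<omega>"] by linarith

lemma abs_S_le: "k \<le> n \<Longrightarrow> \<bar>S k \<omega>\<bar> \<le> l + max_excess l n \<omega>"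
  using max_excess_ge[of k n l \<omega>] abs_le_excess[of "S k \<omega>" l] by linarith

lemma max_excess_square_integrable:
  assumes "0 \<le> l"
  shows "square_integrable M (max_excess l n)"
proof (rule square_integrable_bound)
  show "square_integrable M (\<lambda>\<omega>. \<Sum>k\<le>n. \<bar>S k \<omega>\<bar>)"
    by (intro square_integrable_sum square_integrable_abs S_square_integrable)
  fix \<omega>
  have "max_excess l n \<omega> \<le> (\<Sum>k\<le>n. \<bar>S k \<omega>\<bar>)"
    unfolding max_excess_def
  proof (intro Max.boundedI; clarsimp)
    fix k assume "k \<le> n"
    then have "\<bar>S k \<omega>\<bar> \<le> (\<Sum>k\<le>n. \<bar>S k \<omega>\<bar>)" by (intro member_le_sum) auto
    with excess_le_abs[OF assms, of "S k \<omega>"] show "excess l (S k \<omega>) \<le> (\<Sum>k\<le>n. \<bar>S k \<omega>\<bar>)" by linarith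
  qed
  with max_excess_nonneg[of l n \<omega>] show "\<bar>max_excess l n \<omega>\<bar> \<le> \<bar>\<Sum>k\<le>n. \<bar>S k \<omega>\<bar>\<bar>" by simp
qed measurable

text \<open>
  The martingale property: a step is orthogonal to every function of the steps before it.
  The past is presented as a function \<open>h\<close> on the product space of the first \<open>k\<close> steps,
  because that is the form in which independence of disjoint blocks can be applied.
\<close>
lemma expectation_past_times_step:
  assumes h: "h \<in> borel_measurable (PiM {..<k} (\<lambda>_. borel))"
    and int: "integrable M (\<lambda>\<omega>. h (restrict (\<lambda>i. x i \<omega>) {..<k}))"
  shows "integrable M (\<lambda>\<omega>. h (restrict (\<lambda>i. x i \<omega>) {..<k}) * x k \<omega>)"
    and "expectation (\<lambda>\<omega>. h (restrict (\<lambda>i. x i \<omega>) {..<k}) * x k \<omega>) = 0"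
proof -
  have "indep_var borel (h \<circ> (\<lambda>\<omega>. restrict (\<lambda>i. x i \<omega>) {..<k}))
      borel ((\<lambda>f. f k) \<circ> (\<lambda>\<omega>. restrict (\<lambda>i. x i \<omega>) {k}))"
    by (intro indep_var_compose[OF indep_var_restrict[OF indep]] h) auto
  then have ind: "indep_var borel (\<lambda>\<omega>. h (restrict (\<lambda>i. x i \<omega>) {..<k})) borel (x k)"
    by (simp add: comp_def)
  have xk: "integrable M (x k)" using sq_int by (rule square_integrable_integrable)
  show "integrable M (\<lambda>\<omega>. h (restrict (\<lambda>i. x i \<omega>) {..<k}) * x k \<omega>)"
    by (rule indep_var_integrable[OF ind int xk])
  show "expectation (\<lambda>\<omega>. h (restrict (\<lambda>i. x i \<omega>) {..<k}) * x k \<omega>) = 0"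
    using indep_var_lebesgue_integral[OF ind int xk] centered by simp
qed

lemma S_past: "i \<le> k \<Longrightarrow> S i \<omega> = (\<Sum>j<i. restrict (\<lambda>i. x i \<omega>) {..<k} j)"
  by (simp add: S_def)

lemma variance_S: "expectation (\<lambda>\<omega>. (S n \<omega>)\<^sup>2) = (\<Sum>i<n. expectation (\<lambda>\<omega>. (x i \<omega>)\<^sup>2))"
proof (induction n)
  case 0
  then show ?case by (simp add: S_def)
next
  case (Suc n)
  let ?h = "\<lambda>f. \<Sum>j<n. f j :: real"
  have h: "?h \<in> borel_measurable (PiM {..<n} (\<lambda>_. borel))" by measurable
  have e: "?h (restrict (\<lambda>i. x i \<omega>) {..<n}) = S n \<omega>" for \<omega>
    using S_past[of n n \<omega>] by simp
  have "integrable M (S n)" by (rule square_integrable_integrable[OF S_square_integrable])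
  note past = expectation_past_times_step[OF h, unfolded e, OF this]
  have "(\<lambda>\<omega>. (S (Suc n) \<omega>)\<^sup>2) = (\<lambda>\<omega>. (S n \<omega>)\<^sup>2 + (x n \<omega>)\<^sup>2 + 2 * (S n \<omega> * x n \<omega>))"
    by (simp add: S_Suc power2_sum mult.assoc)
  then have "expectation (\<lambda>\<omega>. (S (Suc n) \<omega>)\<^sup>2)
      = expectation (\<lambda>\<omega>. (S n \<omega>)\<^sup>2) + expectation (\<lambda>\<omega>. (x n \<omega>)\<^sup>2)"
    using past square_integrable_power2[OF S_square_integrable] square_integrable_power2[OF sq_int]
    by simp
  with Suc show ?case by simp
qed

lemma expectation_S: "expectation (S n) = 0"
  unfolding S_def by (subst Bochner_Integration.integral_sum) (auto simp: centered square_integrable_integrable[OF sq_int])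

text \<open>
  By convexity the increments of \<open>excess l (S k)\<close> dominate \<open>excess_slope l (S k) * x k\<close>.
  Inserted into the pathwise inequality, this replaces the stochastic integral by a sum of
  products of the past with the next step, each of expectation zero.
\<close>
theorem maximal_inequality:
  assumes l: "0 \<le> l"
  shows "expectation (\<lambda>\<omega>. (max_excess l n \<omega>)\<^sup>2) \<le> 4 * expectation (\<lambda>\<omega>. (excess l (S n \<omega>))\<^sup>2)"
proof -
  let ?w = "\<lambda>k \<omega>. max_excess l k \<omega> * excess_slope l (S k \<omega>)"
  have step: "integrable M (\<lambda>\<omega>. ?w k \<omega> * x k \<omega>) \<and> expectation (\<lambda>\<omega>. ?w k \<omega> * x k \<omega>) = 0" for k
  proof -
    let ?h = "\<lambda>f. Max ((\<lambda>i. excess l (\<Sum>j<i. f j)) ` {..k}) * excess_slope l (\<Sum>j<k. f j :: real)"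
    have [measurable]: "(\<lambda>f. f j) \<in> borel_measurable (PiM {..<k} (\<lambda>_. borel))" if "j < k" for j
      using that by (intro measurable_component_singleton) simp
    have h: "?h \<in> borel_measurable (PiM {..<k} (\<lambda>_. borel))"
      by (intro borel_measurable_times borel_measurable_Max measurable_compose[OF _ excess_measurable]
          measurable_compose[OF _ excess_slope_measurable] borel_measurable_sum) auto
    have e: "?h (restrict (\<lambda>i. x i \<omega>) {..<k}) = ?w k \<omega>" for \<omega>
    proof -
      have "(\<lambda>i. excess l (\<Sum>j<i. restrict (\<lambda>i. x i \<omega>) {..<k} j)) ` {..k} = (\<lambda>i. excess l (S i \<omega>)) ` {..k}"
        by (intro image_cong refl) (simp add: S_past)
      then show ?thesis using S_past[of k k \<omega>] by (simp add: max_excess_def)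
    qed
    have "integrable M (?w k)"
    proof (rule Bochner_Integration.integrable_bound)
      show "integrable M (max_excess l k)"
        by (rule square_integrable_integrable[OF max_excess_square_integrable[OF l]])
      show "AE \<omega> in M. norm (?w k \<omega>) \<le> norm (max_excess l k \<omega>)"
        by (auto simp: excess_slope_def)
    qed measurable
    from expectation_past_times_step[OF h, unfolded e, OF this] show ?thesis by simp
  qed
  have pathwise: "(max_excess l n \<omega>)\<^sup>2 \<le> 4 * (excess l (S n \<omega>))\<^sup>2 - 4 * (\<Sum>k<n. ?w k \<omega> * x k \<omega>)" for \<omega>
  proof -
    have "(\<Sum>k<n. ?w k \<omega> * x k \<omega>)
        \<le> (\<Sum>k<n. max_excess l k \<omega> * (excess l (S (Suc k) \<omega>) - excess l (S k \<omega>)))"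
    proof (intro sum_mono)
      fix k
      have "excess_slope l (S k \<omega>) * x k \<omega> \<le> excess l (S (Suc k) \<omega>) - excess l (S k \<omega>)"
        using excess_subgradient[OF l, of "S k \<omega>" "x k \<omega>"] by (simp add: S_Suc)
      from mult_left_mono[OF this max_excess_nonneg[of l k \<omega>]]
      show "?w k \<omega> * x k \<omega> \<le> max_excess l k \<omega> * (excess l (S (Suc k) \<omega>) - excess l (S k \<omega>))"
        by (simp add: mult.assoc)
    qed
    with pathwise_maximal[of "\<lambda>k. excess l (S k \<omega>)" n] show ?thesis
      unfolding max_excess_def by linarith
  qed
  have ex: "integrable M (\<lambda>\<omega>. (excess l (S n \<omega>))\<^sup>2)"
  proof (rule square_integrable_power2, rule square_integrable_bound[OF S_square_integrable[of n]])
    show "\<bar>excess l (S n \<omega>)\<bar> \<le> \<bar>S n \<omega>\<bar>" for \<omega>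
      using excess_nonneg[of l "S n \<omega>"] excess_le_abs[OF l, of "S n \<omega>"] by simp
  qed measurable
  have int: "integrable M (\<lambda>\<omega>. \<Sum>k<n. ?w k \<omega> * x k \<omega>)"
    using step by (intro Bochner_Integration.integrable_sum) blast
  have "expectation (\<lambda>\<omega>. (max_excess l n \<omega>)\<^sup>2)
      \<le> expectation (\<lambda>\<omega>. 4 * (excess l (S n \<omega>))\<^sup>2 - 4 * (\<Sum>k<n. ?w k \<omega> * x k \<omega>))"
    using ex int square_integrable_power2[OF max_excess_square_integrable[OF l]]
    by (intro integral_mono pathwise) auto
  also have "\<dots> = 4 * expectation (\<lambda>\<omega>. (excess l (S n \<omega>))\<^sup>2) - 4 * expectation (\<lambda>\<omega>. \<Sum>k<n. ?w k \<omega> * x k \<omega>)"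
    using ex int by simp
  also have "expectation (\<lambda>\<omega>. \<Sum>k<n. ?w k \<omega> * x k \<omega>) = (\<Sum>k<n. expectation (\<lambda>\<omega>. ?w k \<omega> * x k \<omega>))"
    using step by (intro Bochner_Integration.integral_sum) blast
  also have "\<dots> = 0" using step by simp
  finally show ?thesis by simp
qed

lemma shifted_walk: "centered_walk M (\<lambda>i. x (q + i))"
proof
  show "indep_vars (\<lambda>_. borel) (\<lambda>i. x (q + i)) UNIV"
    using indep_vars_reindex[OF indep, of "\<lambda>i. q + i"] by (simp add: inj_on_def)
qed (auto simp: sq_int centered)

end

section \<open>Uniform integrability of the normalised walk\<close>

text \<open>
  The truncation at \<open>k\<^sup>2\<close> makes the square a bounded continuous function, to which weak
  convergence applies.
\<close>
lemma truncated_second_moment_normal: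
  "(\<lambda>k. LINT w|std_normal_distribution. min (w\<^sup>2) ((real k)\<^sup>2)) \<longlonglongrightarrow> 1"
proof -
  have int: "integrable std_normal_distribution (\<lambda>w. w\<^sup>2)"
    by (rule integrable_std_normal_distribution_moment)
  have "(\<lambda>k. LINT w|std_normal_distribution. min (w\<^sup>2) ((real k)\<^sup>2)) \<longlonglongrightarrow> (LINT w|std_normal_distribution. w\<^sup>2)"
  proof (rule integral_dominated_convergence)
    show "AE w in std_normal_distribution. (\<lambda>k. min (w\<^sup>2) ((real k)\<^sup>2)) \<longlonglongrightarrow> w\<^sup>2"
    proof (rule AE_I2)
      fix w :: real
      have "min (w\<^sup>2) ((real k)\<^sup>2) = w\<^sup>2" if "nat \<lceil>\<bar>w\<bar>\<rceil> \<le> k" for k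
      proof -
        have "\<bar>w\<bar> \<le> \<bar>real k\<bar>" using that by linarith
        then show ?thesis unfolding abs_le_square_iff by simp
      qed
      then have "\<forall>\<^sub>F k in sequentially. min (w\<^sup>2) ((real k)\<^sup>2) = w\<^sup>2"
        unfolding eventually_sequentially by blast
      then show "(\<lambda>k. min (w\<^sup>2) ((real k)\<^sup>2)) \<longlonglongrightarrow> w\<^sup>2" by (rule tendsto_eventually)
    qed
  qed (use int in auto)
  then show ?thesis using std_normal_distribution_even_moments(1)[of 1] by simp
qed

locale iid_centered_walk = centered_walk +
  assumes ident: "\<And>i. distr M borel (x i) = distr M borel (x 0)"
begin

definition step_variance :: real where "step_variance = expectation (\<lambda>\<omega>. (x 0 \<omega>)\<^sup>2)"

lemma step_variance_nonneg: "0 \<le> step_variance"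
  by (simp add: step_variance_def)

lemma expectation_step_square: "expectation (\<lambda>\<omega>. (x i \<omega>)\<^sup>2) = step_variance"
proof -
  have "expectation (\<lambda>\<omega>. (x j \<omega>)\<^sup>2) = (LINT t|distr M borel (x j). t\<^sup>2)" for j
    by (subst integral_distr) auto
  then show ?thesis unfolding step_variance_def using ident[of i] by metis
qed

lemma expectation_S_square: "expectation (\<lambda>\<omega>. (S n \<omega>)\<^sup>2) = real n * step_variance"
  by (simp add: variance_S expectation_step_square)

lemma excess_S_square_integrable: "0 \<le> l \<Longrightarrow> square_integrable M (\<lambda>\<omega>. excess l (S n \<omega>))"
proof (rule square_integrable_bound[OF S_square_integrable[of n]])
  fix \<omega> assume "0 \<le> l"
  then show "\<bar>excess l (S n \<omega>)\<bar> \<le> \<bar>S n \<omega>\<bar>"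
    using excess_nonneg[of l "S n \<omega>"] excess_le_abs[of l "S n \<omega>"] by simp
qed measurable

lemma normalised_sum_converges:
  assumes "step_variance > 0"
  shows "weak_conv_m (\<lambda>n. distr M borel (\<lambda>\<omega>. S n \<omega> / sqrt (real n * step_variance))) std_normal_distribution"
proof -
  have "weak_conv_m (\<lambda>n. distr M borel (\<lambda>\<omega>. (\<Sum>i<n. x i \<omega>) / sqrt (real n * (sqrt step_variance)\<^sup>2)))
     std_normal_distribution"
  proof (rule central_limit_theorem_zero_mean[OF indep centered _ _ _ ident])
    show "variance (x n) = (sqrt step_variance)\<^sup>2" for n
      by (simp add: centered expectation_step_square step_variance_nonneg)
  qed (use assms in \<open>auto intro: square_integrable_power2 sq_int\<close>)
  then show ?thesis by (simp add: S_def step_variance_nonneg)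
qed

text \<open>
  The squares of \<open>S n / \<surd>n\<close> are uniformly integrable. They converge in distribution to the
  square of a normal variable by the central limit theorem, and all of them have the same
  expectation as that limit; hence no mass can escape to infinity.
\<close>
lemma excess_S_small:
  assumes e: "0 < e"
  shows "\<exists>K\<ge>0. \<forall>\<^sub>F n in sequentially. expectation (\<lambda>\<omega>. (excess (K * sqrt (real n)) (S n \<omega>))\<^sup>2) \<le> e * real n"
proof (cases "step_variance = 0")
  case True
  have "expectation (\<lambda>\<omega>. (excess 0 (S n \<omega>))\<^sup>2) \<le> e * real n" for n
    using expectation_S_square[of n] True e by (simp add: excess_def)
  then show ?thesis by (intro exI[of _ 0]) simp
next
  case False
  define s where "s = step_variance"
  have s: "s > 0" using False step_variance_nonneg by (simp add: s_def)
  define q where "q = e / s"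
  have q: "q > 0" using e s by (simp add: q_def)
  define W where "W n \<omega> = S n \<omega> / sqrt (real n * s)" for n \<omega>
  have W_meas[measurable]: "W n \<in> borel_measurable M" for n unfolding W_def by measurable
  have W: "weak_conv_m (\<lambda>n. distr M borel (W n)) std_normal_distribution"
    using normalised_sum_converges s unfolding W_def[abs_def] s_def by simp
  have "\<forall>\<^sub>F k in sequentially. 1 - q / 2 < (LINT w|std_normal_distribution. min (w\<^sup>2) ((real k)\<^sup>2))"
    using truncated_second_moment_normal q by (intro order_tendstoD(1)) auto
  then obtain k :: nat where k: "1 - q / 2 < (LINT w|std_normal_distribution. min (w\<^sup>2) ((real k)\<^sup>2))"
    by (auto simp: eventually_sequentially)
  \<comment> \<open>The central limit theorem moves the bound for the normal law to \<open>W n\<close>, at the cost of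
    the other half of \<open>q\<close>.\<close>
  let ?h = "\<lambda>w. min (w\<^sup>2) ((real k)\<^sup>2)"
  have "(\<lambda>n. integral\<^sup>L (distr M borel (W n)) ?h) \<longlonglongrightarrow> (LINT w|std_normal_distribution. ?h w)"
    by (rule weak_conv_imp_integral_bdd_continuous_conv[OF _ real_dist_normal_dist W, where B = "(real k)\<^sup>2"])
       (auto intro!: continuous_intros real_distribution_distr)
  moreover have "1 - e / s < (LINT w|std_normal_distribution. ?h w)"
    using k q unfolding q_def[symmetric] by linarith
  ultimately have "\<forall>\<^sub>F n in sequentially. 1 - e / s < integral\<^sup>L (distr M borel (W n)) ?h"
    by (rule order_tendstoD(1))
  then have ev: "\<forall>\<^sub>F n in sequentially. 1 - e / s < expectation (\<lambda>\<omega>. ?h (W n \<omega>))"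
    by (simp add: integral_distr)
  have "\<forall>\<^sub>F n in sequentially. expectation (\<lambda>\<omega>. (excess ((real k * sqrt s) * sqrt (real n)) (S n \<omega>))\<^sup>2) \<le> e * real n"
    using ev eventually_gt_at_top[of 0]
  proof eventually_elim
    case (elim n)
    define c where "c = sqrt (real n * s)"
    have c: "c > 0" "c\<^sup>2 = real n * s" using s elim by (simp_all add: c_def)
    have S_eq: "S n \<omega> = c * W n \<omega>" for \<omega> using elim s by (simp add: W_def c_def)
    have K_eq: "(real k * sqrt s) * sqrt (real n) = c * real k" by (simp add: c_def real_sqrt_mult)
    have W_sq: "expectation (\<lambda>\<omega>. (W n \<omega>)\<^sup>2) = 1"
      using expectation_S_square[of n] c elim s by (simp add: W_def power_divide s_def c_def)
    have W_int: "integrable M (\<lambda>\<omega>. (W n \<omega>)\<^sup>2)"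
      using square_integrable_power2[OF S_square_integrable] by (simp add: W_def power_divide)
    have h_int: "integrable M (\<lambda>\<omega>. ?h (W n \<omega>))"
      by (rule integrable_const_bound[where B="(real k)\<^sup>2"]) auto
    have "expectation (\<lambda>\<omega>. (excess (c * real k) (S n \<omega>))\<^sup>2) \<le> expectation (\<lambda>\<omega>. c\<^sup>2 * ((W n \<omega>)\<^sup>2 - ?h (W n \<omega>)))"
    proof (rule integral_mono)
      show "integrable M (\<lambda>\<omega>. (excess (c * real k) (S n \<omega>))\<^sup>2)"
        using c by (intro square_integrable_power2 excess_S_square_integrable) simp
      show "(excess (c * real k) (S n \<omega>))\<^sup>2 \<le> c\<^sup>2 * ((W n \<omega>)\<^sup>2 - ?h (W n \<omega>))" for \<omega>
        using excess_square_le[of "real k" "W n \<omega>"] c(1)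
        by (simp add: S_eq excess_scale power_mult_distrib)
    qed (use W_int h_int in auto)
    also have "\<dots> = c\<^sup>2 * (1 - expectation (\<lambda>\<omega>. ?h (W n \<omega>)))"
      using W_int h_int W_sq by simp
    also have "\<dots> \<le> c\<^sup>2 * (e / s)" using elim by (intro mult_left_mono) auto
    also have "\<dots> = e * real n" using c s by simp
    finally show ?case by (simp add: K_eq)
  qed
  then show ?thesis using s by (intro exI[of _ "real k * sqrt s"]) simp
qed

text \<open>
  Allowing every larger \<open>K'\<close> lets one constant serve several walks at the same time.
\<close>
lemma max_excess_small:
  assumes "0 < e"
  shows "\<exists>K. \<forall>K'\<ge>K. \<forall>\<^sub>F n in sequentially. expectation (\<lambda>\<omega>. (max_excess (K' * sqrt (real n)) n \<omega>)\<^sup>2) \<le> e * real n"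
proof -
  obtain K where K: "K \<ge> 0"
    "\<forall>\<^sub>F n in sequentially. expectation (\<lambda>\<omega>. (excess (K * sqrt (real n)) (S n \<omega>))\<^sup>2) \<le> e / 4 * real n"
    using excess_S_small[of "e / 4"] assms by auto
  have "\<forall>\<^sub>F n in sequentially. expectation (\<lambda>\<omega>. (max_excess (K' * sqrt (real n)) n \<omega>)\<^sup>2) \<le> e * real n"
    if K': "K' \<ge> K" for K'
    using K(2)
  proof eventually_elim
    case (elim n)
    have "expectation (\<lambda>\<omega>. (max_excess (K' * sqrt (real n)) n \<omega>)\<^sup>2)
        \<le> 4 * expectation (\<lambda>\<omega>. (excess (K' * sqrt (real n)) (S n \<omega>))\<^sup>2)"
      using K K' by (intro maximal_inequality) simp
    also have "\<dots> \<le> 4 * expectation (\<lambda>\<omega>. (excess (K * sqrt (real n)) (S n \<omega>))\<^sup>2)"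
      using K K' by (intro mult_left_mono integral_mono square_integrable_power2 excess_S_square_integrable
          power_mono excess_antimono mult_right_mono excess_nonneg) auto
    finally show ?case using elim by simp
  qed
  then show ?thesis by blast
qed

lemma expectation_max_square_le:
  "expectation (\<lambda>\<omega>. (max_excess 0 n \<omega>)\<^sup>2) \<le> 4 * (real n * step_variance)"
  using maximal_inequality[of 0 n] expectation_S_square[of n] by (simp add: excess_def)

text \<open>
  The final stretch of a path is estimated by the maximal inequality for the walk that starts
  at time \<open>q\<close>.
\<close>
lemma shifted_iid_walk: "iid_centered_walk M (\<lambda>i. x (q + i))"
proof -
  interpret sh: centered_walk M "\<lambda>i. x (q + i)" by (rule shifted_walk)
  show ?thesis
  proof
    show "distr M borel (x (q + i)) = distr M borel (x (q + 0))" for i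
      using ident[of "q + i"] ident[of q] by simp
  qed
qed

lemma shifted_step_variance: "iid_centered_walk.step_variance M (\<lambda>i. x (q + i)) = step_variance"
proof -
  interpret sh: iid_centered_walk M "\<lambda>i. x (q + i)" by (rule shifted_iid_walk)
  show ?thesis unfolding sh.step_variance_def by (simp add: expectation_step_square)
qed

lemma shifted_S: "centered_walk.S (\<lambda>i. x (q + i)) k \<omega> = S (q + k) \<omega> - S q \<omega>"
proof -
  interpret sh: centered_walk M "\<lambda>i. x (q + i)" by (rule shifted_walk)
  have "S (q + k) \<omega> = S q \<omega> + sh.S k \<omega>"
    by (induction k) (simp_all add: S_def sh.S_def)
  then show ?thesis by simp
qed

end

section \<open>Geometry of a drifting path\<close>

text \<open>
  A transversal displacement \<open>V\<close> lengthens a vector of length \<open>M\<close> by at most \<open>V\<^sup>2 / (2 M)\<close>. The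
  part of \<open>V\<close> of size \<open>2 l\<close> is charged this quadratic price, which is bounded if \<open>M\<close> is of order
  \<open>n\<close> and \<open>l\<close> of order \<open>\<surd>n\<close>; the rest is charged its full length.
\<close>
lemma hypot_le_drifting:
  fixes M l b U V :: real
  assumes "0 < M" "\<bar>U\<bar> \<le> M" "0 \<le> l" "0 \<le> b" "\<bar>V\<bar> \<le> 2 * l + 2 * b"
  shows "sqrt (U\<^sup>2 + V\<^sup>2) \<le> M + 2 * l\<^sup>2 / M + 2 * b"
proof (rule real_le_lsqrt)
  define d where "d = 2 * l\<^sup>2 / M"
  have d: "0 \<le> d" "2 * M * d = 4 * l\<^sup>2" using assms by (simp_all add: d_def)
  have "(2 * l)\<^sup>2 = 4 * l\<^sup>2" by (simp add: power_mult_distrib)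
  then have "(2 * l)\<^sup>2 \<le> (M + d)\<^sup>2"
    unfolding power2_sum using d zero_le_power2[of M] zero_le_power2[of d] by linarith
  then have ld: "2 * l \<le> M + d" using power2_le_imp_le[of "2 * l" "M + d"] d assms by simp
  have "U\<^sup>2 + V\<^sup>2 \<le> M\<^sup>2 + (2 * l + 2 * b)\<^sup>2"
    using assms by (intro add_mono) (auto simp: abs_le_square_iff[symmetric])
  also have "\<dots> = M\<^sup>2 + 4 * l\<^sup>2 + 4 * b * (2 * l) + (2 * b)\<^sup>2"
    by (simp add: power2_eq_square algebra_simps)
  also have "\<dots> \<le> M\<^sup>2 + 4 * l\<^sup>2 + 4 * b * (M + d) + (2 * b)\<^sup>2"
    using mult_left_mono[OF ld, of "4 * b"] assms by simp
  also have "\<dots> \<le> (M + d + 2 * b)\<^sup>2"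
  proof -
    have "0 \<le> d\<^sup>2" by simp
    with d show ?thesis by (simp add: power2_eq_square algebra_simps)
  qed
  finally show "U\<^sup>2 + V\<^sup>2 \<le> (M + 2 * l\<^sup>2 / M + 2 * b)\<^sup>2" by (simp add: d_def)
  show "0 \<le> M + 2 * l\<^sup>2 / M + 2 * b" using assms by simp
qed

text \<open>
  A path \<open>t\<close> with drift \<open>m\<close> never falls far below its start and never rises far above its end.
  After \<open>p\<close> steps the drift has gained \<open>2 l\<close>, which pays for fluctuations of size \<open>l\<close>; so an
  excursion below the start needs either an early fluctuation (bounded by \<open>\<alpha>\<close>) or a fluctuation
  that exceeds \<open>l\<close> (by at most \<open>a\<close>). The last \<open>p\<close> steps are treated alike, with \<open>\<beta>\<close>.
  If all values lie between \<open>- A\<close> and \<open>t n + B\<close>, then any two of them, in either order, differ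
  by at most \<open>t n + A + B\<close>. The transversal coordinate \<open>v\<close> is added at the end.
\<close>
lemma drifting_path_extent_le:
  fixes u v :: "nat \<Rightarrow> real" and m :: real
  defines "t \<equiv> \<lambda>k. m * real k + u k"
  assumes m: "0 < m" and n: "0 < n" and l: "0 \<le> l" "2 * l \<le> m * real n"
    and p: "p \<le> n" "2 * l \<le> m * real p"
    and a: "0 \<le> a" "\<And>k. k \<le> n \<Longrightarrow> \<bar>u k\<bar> \<le> l + a"
    and b: "0 \<le> b" "\<And>k. k \<le> n \<Longrightarrow> \<bar>v k\<bar> \<le> l + b"
    and \<alpha>: "\<And>k. k \<le> p \<Longrightarrow> \<bar>u k\<bar> \<le> \<alpha>"
    and \<beta>: "\<And>k. k \<le> p \<Longrightarrow> \<bar>u (n - p + k) - u (n - p)\<bar> \<le> \<beta>"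
    and ij: "i \<le> n" "j \<le> n"
  shows "sqrt ((t i - t j)\<^sup>2 + (v i - v j)\<^sup>2) \<le> t n + \<alpha> + 2 * \<beta> + 4 * a + 2 * b + 4 * l\<^sup>2 / (m * real n)"
proof -
  have \<alpha>\<beta>: "0 \<le> \<alpha>" "0 \<le> \<beta>" using \<alpha>[of 0] \<beta>[of 0] by auto
  have lower: "- (\<alpha> + a) \<le> t k" if k: "k \<le> n" for k
  proof (cases "k \<le> p")
    case True
    have "0 \<le> m * real k" using m by simp
    with \<alpha>[OF True] a(1) show ?thesis unfolding t_def by linarith
  next
    case False
    then have "m * real p \<le> m * real k" using m by simp
    with a(2)[OF k] p(2) \<alpha>\<beta> l show ?thesis unfolding t_def by linarith
  qed
  have upper: "t k \<le> t n + (2 * \<beta> + 2 * a)" if k: "k \<le> n" for k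
  proof (cases "k \<le> n - p")
    case True
    then have "real p \<le> real n - real k" using p(1) by linarith
    then have "m * real p \<le> m * (real n - real k)" using m by simp
    then have "2 * l \<le> m * real n - m * real k" using p(2) by (simp add: right_diff_distrib)
    with a(2)[OF k] a(2)[of n] \<alpha>\<beta> show ?thesis unfolding t_def by auto
  next
    case False
    define k' where "k' = k - (n - p)"
    have k': "k' \<le> p" "n - p + k' = k" using False k by (auto simp: k'_def)
    have "m * real k \<le> m * real n" using k m by simp
    moreover have "\<bar>u n - u (n - p)\<bar> \<le> \<beta>" using \<beta>[of p] p by simp
    moreover have "\<bar>u k - u (n - p)\<bar> \<le> \<beta>" using \<beta>[of k'] k' by simp
    ultimately show ?thesis using a(1) unfolding t_def by linarith
  qed
  define M where "M = t n + \<alpha> + 2 * \<beta> + 4 * a"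
  have mn: "0 < m * real n" using m n by simp
  have M: "m * real n / 2 \<le> M"
    using a(2)[of n] l \<alpha>\<beta> a(1) unfolding M_def t_def by (auto simp: abs_le_iff)
  have "\<bar>t i - t j\<bar> \<le> M"
    using lower[OF ij(1)] lower[OF ij(2)] upper[OF ij(1)] upper[OF ij(2)] a(1) unfolding M_def by linarith
  moreover have "\<bar>v i - v j\<bar> \<le> 2 * l + 2 * b" using b(2)[OF ij(1)] b(2)[OF ij(2)] by linarith
  ultimately have "sqrt ((t i - t j)\<^sup>2 + (v i - v j)\<^sup>2) \<le> M + 2 * l\<^sup>2 / M + 2 * b"
    using M mn l b(1) by (intro hypot_le_drifting) auto
  also have "2 * l\<^sup>2 / M \<le> 2 * l\<^sup>2 / (m * real n / 2)"
    using M mn by (intro divide_left_mono) auto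
  finally show ?thesis by (simp add: M_def)
qed

section \<open>Limit theorems for a walk with a small perturbation\<close>

context prob_space
begin

text \<open>
  A Slutsky theorem: \<open>s \<mapsto> exp (i t s)\<close> is Lipschitz with constant \<open>|t|\<close>, so \<open>L\<^sup>1\<close>-close
  variables have close characteristic functions, and Levy's continuity theorem applies.
\<close>
lemma weak_conv_of_L1_close:
  fixes X Y :: "nat \<Rightarrow> 'a \<Rightarrow> real"
  assumes X[measurable]: "\<And>n. X n \<in> borel_measurable M" and Y[measurable]: "\<And>n. Y n \<in> borel_measurable M"
    and int: "\<And>n. integrable M (\<lambda>\<omega>. Y n \<omega> - X n \<omega>)"
    and close: "(\<lambda>n. expectation (\<lambda>\<omega>. \<bar>Y n \<omega> - X n \<omega>\<bar>)) \<longlonglongrightarrow> 0"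
    and N: "real_distribution N" and conv: "weak_conv_m (\<lambda>n. distr M borel (X n)) N"
  shows "weak_conv_m (\<lambda>n. distr M borel (Y n)) N"
proof (rule levy_continuity)
  show "real_distribution (distr M borel (Y n))" for n by (intro real_distribution_distr) measurable
  fix t
  have char: "char (distr M borel f) t = expectation (\<lambda>\<omega>. iexp (t * f \<omega>))"
    if [measurable]: "f \<in> borel_measurable M" for f
    unfolding char_def by (subst integral_distr) auto
  have int_iexp: "integrable M (\<lambda>\<omega>. iexp (t * f \<omega>))"
    if [measurable]: "f \<in> borel_measurable M" for f
    by (rule integrable_const_bound[where B = 1]) auto
  have X_lim: "(\<lambda>n. char (distr M borel (X n)) t) \<longlonglongrightarrow> char N t"
    by (intro levy_continuity1 real_distribution_distr N conv) measurable
  have "(\<lambda>n. char (distr M borel (Y n)) t - char (distr M borel (X n)) t) \<longlonglongrightarrow> 0"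
  proof (rule Lim_null_comparison)
    show "(\<lambda>n. \<bar>t\<bar> * expectation (\<lambda>\<omega>. \<bar>Y n \<omega> - X n \<omega>\<bar>)) \<longlonglongrightarrow> 0"
      using tendsto_mult_right_zero[OF close] by simp
    show "\<forall>\<^sub>F n in sequentially. cmod (char (distr M borel (Y n)) t - char (distr M borel (X n)) t)
        \<le> \<bar>t\<bar> * expectation (\<lambda>\<omega>. \<bar>Y n \<omega> - X n \<omega>\<bar>)"
    proof (rule always_eventually, rule allI)
      fix n
      have lipschitz: "cmod (iexp (t * b) - iexp (t * a)) \<le> \<bar>t\<bar> * \<bar>b - a\<bar>" for a b
      proof -
        have "iexp (t * b) - iexp (t * a) = iexp (t * a) * (iexp (t * (b - a)) - 1)"
          by (simp add: algebra_simps flip: exp_add)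
        then have "cmod (iexp (t * b) - iexp (t * a)) = cmod (iexp (t * (b - a)) - 1)"
          by (simp add: norm_mult)
        also have "\<dots> \<le> \<bar>t * (b - a)\<bar>" using iexp_approx1[of "t * (b - a)" 0] by simp
        finally show ?thesis by (simp add: abs_mult)
      qed
      have "cmod (char (distr M borel (Y n)) t - char (distr M borel (X n)) t)
          = cmod (expectation (\<lambda>\<omega>. iexp (t * Y n \<omega>) - iexp (t * X n \<omega>)))"
        by (subst Bochner_Integration.integral_diff) (simp_all add: char int_iexp del: of_real_mult)
      also have "\<dots> \<le> expectation (\<lambda>\<omega>. cmod (iexp (t * Y n \<omega>) - iexp (t * X n \<omega>)))"
        by (rule integral_norm_bound)
      also have "\<dots> \<le> expectation (\<lambda>\<omega>. \<bar>t\<bar> * \<bar>Y n \<omega> - X n \<omega>\<bar>)"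
      proof (rule integral_mono)
        show "integrable M (\<lambda>\<omega>. cmod (iexp (t * Y n \<omega>) - iexp (t * X n \<omega>)))"
          by (intro integrable_norm Bochner_Integration.integrable_diff int_iexp X Y)
        show "integrable M (\<lambda>\<omega>. \<bar>t\<bar> * \<bar>Y n \<omega> - X n \<omega>\<bar>)"
          by (intro integrable_mult_right integrable_abs int)
      qed (rule lipschitz)
      finally show "cmod (char (distr M borel (Y n)) t - char (distr M borel (X n)) t)
        \<le> \<bar>t\<bar> * expectation (\<lambda>\<omega>. \<bar>Y n \<omega> - X n \<omega>\<bar>)" by simp
    qed
  qed
  from tendsto_add[OF this X_lim] show "(\<lambda>n. char (distr M borel (Y n)) t) \<longlonglongrightarrow> char N t" by simp
qed (rule N)

end

text \<open>
  A walk to which a deterministic centring and a random error of size \<open>o(\<surd>n)\<close> in \<open>L\<^sup>2\<close> are added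
  has the variance asymptotics and the normal limit of the walk itself. The two central limit
  theorems differ only in the choice of centring and scale.
\<close>
locale perturbed_walk = iid_centered_walk +
  fixes c :: "nat \<Rightarrow> real" and R :: "nat \<Rightarrow> 'a \<Rightarrow> real"
  assumes R_sq: "\<And>n. square_integrable M (R n)"
    and R_small: "(\<lambda>n. expectation (\<lambda>\<omega>. (R n \<omega>)\<^sup>2) / real n) \<longlonglongrightarrow> 0"
begin

definition D :: "nat \<Rightarrow> 'a \<Rightarrow> real" where "D n \<omega> = c n + S n \<omega> + R n \<omega>"

definition r :: "nat \<Rightarrow> 'a \<Rightarrow> real" where "r n \<omega> = R n \<omega> - expectation (R n)"

lemma D_measurable[measurable]: "D n \<in> borel_measurable M"
  using square_integrable_measurable[OF R_sq] unfolding D_def by measurable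

lemma D_centered: "D n \<omega> - expectation (D n) = S n \<omega> + r n \<omega>"
proof -
  have "expectation (D n) = c n + expectation (R n)"
    unfolding D_def using square_integrable_integrable[OF R_sq] square_integrable_integrable[OF S_square_integrable]
    by (simp add: expectation_S prob_space)
  then show ?thesis by (simp add: D_def r_def)
qed

lemma r_sq: "square_integrable M (r n)"
  unfolding r_def by (intro square_integrable_diff R_sq square_integrable_const)

lemma r_square_le: "expectation (\<lambda>\<omega>. (r n \<omega>)\<^sup>2) \<le> expectation (\<lambda>\<omega>. (R n \<omega>)\<^sup>2)"
  unfolding r_def using square_integrable_integrable[OF R_sq] square_integrable_power2[OF R_sq]
  by (subst variance_eq) auto

lemma r_small: "(\<lambda>n. expectation (\<lambda>\<omega>. (r n \<omega>)\<^sup>2) / real n) \<longlonglongrightarrow> 0"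
  by (rule tendsto_sandwich[OF _ _ tendsto_const R_small])
     (auto intro!: divide_right_mono r_square_le always_eventually)

lemma variance_D:
  "variance (D n) = real n * step_variance + 2 * expectation (\<lambda>\<omega>. S n \<omega> * r n \<omega>) + expectation (\<lambda>\<omega>. (r n \<omega>)\<^sup>2)"
  using square_integrable_power2[OF S_square_integrable[of n]] square_integrable_power2[OF r_sq[of n]]
    square_integrable_mult[OF S_square_integrable r_sq, of n n]
  by (simp add: D_centered power2_sum mult.assoc expectation_S_square)

text \<open>
  The covariance of \<open>S n\<close> and the error is at most \<open>O(\<surd>n)\<close> times a quantity \<open>o(\<surd>n)\<close>, by the
  Cauchy-Schwarz inequality.
\<close>
lemma variance_limit: "(\<lambda>n. variance (D n) / real n) \<longlonglongrightarrow> step_variance"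
proof -
  have "(\<lambda>n. 2 * (expectation (\<lambda>\<omega>. S n \<omega> * r n \<omega>) / real n)) \<longlonglongrightarrow> 2 * 0"
  proof (intro tendsto_mult tendsto_const, rule Lim_null_comparison)
    have "(\<lambda>n. sqrt step_variance * sqrt (expectation (\<lambda>\<omega>. (r n \<omega>)\<^sup>2) / real n)) \<longlonglongrightarrow> sqrt step_variance * sqrt 0"
      by (intro tendsto_intros r_small)
    then show "(\<lambda>n. sqrt step_variance * sqrt (expectation (\<lambda>\<omega>. (r n \<omega>)\<^sup>2) / real n)) \<longlonglongrightarrow> 0" by simp
    show "\<forall>\<^sub>F n in sequentially. norm (expectation (\<lambda>\<omega>. S n \<omega> * r n \<omega>) / real n)
        \<le> sqrt step_variance * sqrt (expectation (\<lambda>\<omega>. (r n \<omega>)\<^sup>2) / real n)"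
      using eventually_gt_at_top[of 0]
    proof eventually_elim
      case (elim n)
      have "\<bar>expectation (\<lambda>\<omega>. S n \<omega> * r n \<omega>)\<bar> \<le> sqrt (real n * step_variance) * sqrt (expectation (\<lambda>\<omega>. (r n \<omega>)\<^sup>2))"
        using expectation_cauchy_schwarz[OF S_square_integrable r_sq, of n n] by (simp add: expectation_S_square)
      then have "\<bar>expectation (\<lambda>\<omega>. S n \<omega> * r n \<omega>)\<bar> / real n
          \<le> sqrt (real n * step_variance) * sqrt (expectation (\<lambda>\<omega>. (r n \<omega>)\<^sup>2)) / real n"
        by (intro divide_right_mono) auto
      also have "\<dots> = sqrt step_variance * sqrt (expectation (\<lambda>\<omega>. (r n \<omega>)\<^sup>2) / real n)"
        using elim by (simp add: real_sqrt_mult real_sqrt_divide field_simps)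
      finally show ?case by simp
    qed
  qed
  then have "(\<lambda>n. step_variance + 2 * (expectation (\<lambda>\<omega>. S n \<omega> * r n \<omega>) / real n)
      + expectation (\<lambda>\<omega>. (r n \<omega>)\<^sup>2) / real n) \<longlonglongrightarrow> step_variance + 2 * 0 + 0"
    by (intro tendsto_add tendsto_const r_small)
  then have "(\<lambda>n. step_variance + 2 * (expectation (\<lambda>\<omega>. S n \<omega> * r n \<omega>) / real n)
      + expectation (\<lambda>\<omega>. (r n \<omega>)\<^sup>2) / real n) \<longlonglongrightarrow> step_variance" by simp
  moreover have "\<forall>\<^sub>F n in sequentially. step_variance + 2 * (expectation (\<lambda>\<omega>. S n \<omega> * r n \<omega>) / real n)
      + expectation (\<lambda>\<omega>. (r n \<omega>)\<^sup>2) / real n = variance (D n) / real n"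
    using eventually_gt_at_top[of 0]
    by eventually_elim (simp add: variance_D add_divide_distrib)
  ultimately show ?thesis by (rule Lim_transform_eventually)
qed

text \<open>
  The distance in \<open>L\<^sup>1\<close> to \<open>S n / \<surd>(n s)\<close>, for steps of variance \<open>s\<close>, has two sources: the scale
  \<open>a n\<close> is only asymptotically \<open>1 / \<surd>(n s)\<close>, and the error \<open>q n\<close> is of smaller order than \<open>\<surd>n\<close>.
\<close>
lemma weak_conv_normalised:
  fixes a :: "nat \<Rightarrow> real" and q :: "nat \<Rightarrow> 'a \<Rightarrow> real"
  assumes s: "step_variance > 0"
    and a: "(\<lambda>n. a n * sqrt (real n * step_variance)) \<longlonglongrightarrow> 1"
    and q: "\<And>n. square_integrable M (q n)" "(\<lambda>n. expectation (\<lambda>\<omega>. (q n \<omega>)\<^sup>2) / real n) \<longlonglongrightarrow> 0"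
  shows "weak_conv_m (\<lambda>n. distr M borel (\<lambda>\<omega>. (S n \<omega> + q n \<omega>) * a n)) std_normal_distribution"
proof (rule weak_conv_of_L1_close[OF _ _ _ _ real_dist_normal_dist normalised_sum_converges[OF s]])
  note [measurable] = square_integrable_measurable[OF q(1)]
  show "(\<lambda>\<omega>. S n \<omega> / sqrt (real n * step_variance)) \<in> borel_measurable M" for n by measurable
  show "(\<lambda>\<omega>. (S n \<omega> + q n \<omega>) * a n) \<in> borel_measurable M" for n by measurable
  define d where "d n = a n - 1 / sqrt (real n * step_variance)" for n
  have diff: "(S n \<omega> + q n \<omega>) * a n - S n \<omega> / sqrt (real n * step_variance) = d n * S n \<omega> + a n * q n \<omega>" for n \<omega>
    by (simp add: d_def algebra_simps)
  have int: "integrable M (S n)" "integrable M (q n)" for n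
    using square_integrable_integrable[OF S_square_integrable] square_integrable_integrable[OF q(1)] by auto
  then show "integrable M (\<lambda>\<omega>. (S n \<omega> + q n \<omega>) * a n - S n \<omega> / sqrt (real n * step_variance))" for n
    unfolding diff by auto
  let ?A = "\<lambda>n. a n * sqrt (real n * step_variance)"
  let ?Q = "\<lambda>n. expectation (\<lambda>\<omega>. (q n \<omega>)\<^sup>2) / real n"
  show "(\<lambda>n. expectation (\<lambda>\<omega>. \<bar>(S n \<omega> + q n \<omega>) * a n - S n \<omega> / sqrt (real n * step_variance)\<bar>)) \<longlonglongrightarrow> 0"
  proof (rule Lim_null_comparison)
    have "(\<lambda>n. \<bar>?A n - 1\<bar> + \<bar>?A n\<bar> * (sqrt (?Q n) / sqrt step_variance))
        \<longlonglongrightarrow> \<bar>1 - 1\<bar> + \<bar>1\<bar> * (sqrt 0 / sqrt step_variance)"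
      using s by (intro tendsto_intros a q(2)) auto
    then show "(\<lambda>n. \<bar>?A n - 1\<bar> + \<bar>?A n\<bar> * (sqrt (?Q n) / sqrt step_variance)) \<longlonglongrightarrow> 0" by simp
    show "\<forall>\<^sub>F n in sequentially. norm (expectation (\<lambda>\<omega>. \<bar>(S n \<omega> + q n \<omega>) * a n - S n \<omega> / sqrt (real n * step_variance)\<bar>))
        \<le> \<bar>?A n - 1\<bar> + \<bar>?A n\<bar> * (sqrt (?Q n) / sqrt step_variance)"
      using eventually_gt_at_top[of 0]
    proof eventually_elim
      case (elim n)
      have "expectation (\<lambda>\<omega>. \<bar>d n * S n \<omega> + a n * q n \<omega>\<bar>) \<le> expectation (\<lambda>\<omega>. \<bar>d n\<bar> * \<bar>S n \<omega>\<bar> + \<bar>a n\<bar> * \<bar>q n \<omega>\<bar>)"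
        using int by (intro integral_mono) (auto simp flip: abs_mult)
      also have "\<dots> = \<bar>d n\<bar> * expectation (\<lambda>\<omega>. \<bar>S n \<omega>\<bar>) + \<bar>a n\<bar> * expectation (\<lambda>\<omega>. \<bar>q n \<omega>\<bar>)"
        using int by simp
      also have "\<dots> \<le> \<bar>d n\<bar> * sqrt (real n * step_variance) + \<bar>a n\<bar> * sqrt (expectation (\<lambda>\<omega>. (q n \<omega>)\<^sup>2))"
        using expectation_abs_le_sqrt[OF S_square_integrable, of n] expectation_abs_le_sqrt[OF q(1), of n]
        by (intro add_mono mult_left_mono) (auto simp: expectation_S_square)
      also have "\<bar>d n\<bar> * sqrt (real n * step_variance) = \<bar>d n * sqrt (real n * step_variance)\<bar>"
        using step_variance_nonneg by (simp add: abs_mult)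
      also have "d n * sqrt (real n * step_variance) = ?A n - 1"
        using elim s by (simp add: d_def left_diff_distrib)
      also have "\<bar>a n\<bar> * sqrt (expectation (\<lambda>\<omega>. (q n \<omega>)\<^sup>2)) = \<bar>?A n\<bar> * (sqrt (?Q n) / sqrt step_variance)"
        using elim s by (simp add: abs_mult real_sqrt_mult real_sqrt_divide)
      finally show ?case by (simp add: diff)
    qed
  qed
qed

lemma clt_self_normalised:
  assumes s: "step_variance > 0"
  shows "weak_conv_m (\<lambda>n. distr M borel (\<lambda>\<omega>. (D n \<omega> - expectation (D n)) / sqrt (variance (D n))))
    std_normal_distribution"
proof -
  have "(\<lambda>n. sqrt (step_variance / (variance (D n) / real n))) \<longlonglongrightarrow> sqrt (step_variance / step_variance)"
    using s by (intro tendsto_intros variance_limit) auto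
  then have "(\<lambda>n. 1 / sqrt (variance (D n)) * sqrt (real n * step_variance)) \<longlonglongrightarrow> 1"
    using s by (simp add: real_sqrt_divide real_sqrt_mult mult.commute)
  from weak_conv_normalised[OF s this r_sq r_small] show ?thesis
    by (simp add: D_centered)
qed

lemma clt_deterministic_centring:
  assumes s: "step_variance > 0"
  shows "weak_conv_m (\<lambda>n. distr M borel (\<lambda>\<omega>. (D n \<omega> - c n) / sqrt (real n * step_variance)))
    std_normal_distribution"
proof -
  have "\<forall>\<^sub>F n in sequentially. 1 / sqrt (real n * step_variance) * sqrt (real n * step_variance) = 1"
    using eventually_gt_at_top[of 0] by eventually_elim (use s in simp)
  then have "(\<lambda>n. 1 / sqrt (real n * step_variance) * sqrt (real n * step_variance)) \<longlonglongrightarrow> 1"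
    by (rule tendsto_eventually)
  from weak_conv_normalised[OF s this R_sq R_small] show ?thesis
    by (simp add: D_def)
qed

end

section \<open>The diameter exceeds the drift projection by a negligible amount\<close>

lemma square_sum5_le:
  fixes a b c d e :: real
  shows "(a + b + c + d + e)\<^sup>2 \<le> 5 * (a\<^sup>2 + b\<^sup>2 + c\<^sup>2 + d\<^sup>2 + e\<^sup>2)"
proof -
  have "0 \<le> (a - b)\<^sup>2 + (a - c)\<^sup>2 + (a - d)\<^sup>2 + (a - e)\<^sup>2 + (b - c)\<^sup>2 + (b - d)\<^sup>2 + (b - e)\<^sup>2
      + (c - d)\<^sup>2 + (c - e)\<^sup>2 + (d - e)\<^sup>2" by simp
  then show ?thesis by (simp add: power2_eq_square algebra_simps)
qed

text \<open>
  The planar walk in coordinates along and across the drift: \<open>x\<close> and \<open>y\<close> are the centred steps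
  in these directions, and \<open>m\<close> is the length of the mean step. The joint law of
  \<open>x\<close> and \<open>y\<close> is arbitrary.
\<close>
locale drifting_planar_walk = X: iid_centered_walk M x + Y: iid_centered_walk M y
  for M :: "'a measure" and x y :: "nat \<Rightarrow> 'a \<Rightarrow> real" +
  fixes m :: real
  assumes m: "0 < m"
begin

definition gap :: "'a \<Rightarrow> nat \<times> nat \<Rightarrow> real" where
  "gap \<omega> = (\<lambda>(i, j). sqrt ((m * real i + X.S i \<omega> - (m * real j + X.S j \<omega>))\<^sup>2 + (Y.S i \<omega> - Y.S j \<omega>)\<^sup>2))"

definition extent :: "nat \<Rightarrow> 'a \<Rightarrow> real" where
  "extent n \<omega> = Max (gap \<omega> ` ({..n} \<times> {..n}))"

definition remainder :: "nat \<Rightarrow> 'a \<Rightarrow> real" where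
  "remainder n \<omega> = extent n \<omega> - m * real n - X.S n \<omega>"

lemma remainder_measurable[measurable]: "remainder n \<in> borel_measurable M"
proof -
  have "(\<lambda>\<omega>. Max ((\<lambda>ij. gap \<omega> ij) ` ({..n} \<times> {..n}))) \<in> borel_measurable M"
    by (intro borel_measurable_Max) (auto simp: gap_def split_beta)
  then have [measurable]: "extent n \<in> borel_measurable M" unfolding extent_def .
  show ?thesis unfolding remainder_def by measurable
qed

lemma remainder_nonneg: "0 \<le> remainder n \<omega>"
proof -
  have "m * real n + X.S n \<omega> \<le> sqrt ((m * real n + X.S n \<omega>)\<^sup>2 + (Y.S n \<omega>)\<^sup>2)"
    by (rule real_le_rsqrt) simp
  also have "\<dots> = gap \<omega> (n, 0)" by (simp add: gap_def X.S_def Y.S_def)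
  also have "\<dots> \<le> extent n \<omega>" unfolding extent_def by (intro Max_ge) auto
  finally show ?thesis by (simp add: remainder_def)
qed

lemma remainder_0: "remainder 0 \<omega> = 0"
  by (simp add: remainder_def extent_def gap_def X.S_def Y.S_def)

abbreviation last_steps_max :: "nat \<Rightarrow> nat \<Rightarrow> 'a \<Rightarrow> real" where
  "last_steps_max n p \<equiv> centered_walk.max_excess (\<lambda>i. x (n - p + i)) 0 p"

lemma remainder_le:
  assumes n: "0 < n" and l: "0 \<le> l" "2 * l \<le> m * real n" and p: "p \<le> n" "2 * l \<le> m * real p"
  shows "remainder n \<omega> \<le> X.max_excess 0 p \<omega> + 2 * last_steps_max n p \<omega>
    + 4 * X.max_excess l n \<omega> + 2 * Y.max_excess l n \<omega> + 4 * l\<^sup>2 / (m * real n)"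
proof -
  interpret sh: centered_walk M "\<lambda>i. x (n - p + i)" by (rule X.shifted_walk)
  have "extent n \<omega> \<le> m * real n + X.S n \<omega> + X.max_excess 0 p \<omega> + 2 * sh.max_excess 0 p \<omega>
      + 4 * X.max_excess l n \<omega> + 2 * Y.max_excess l n \<omega> + 4 * l\<^sup>2 / (m * real n)"
    unfolding extent_def
  proof (intro Max.boundedI; clarsimp)
    fix i j assume ij: "i \<le> n" "j \<le> n"
    have "\<bar>X.S (n - p + k) \<omega> - X.S (n - p) \<omega>\<bar> \<le> sh.max_excess 0 p \<omega>" if "k \<le> p" for k
      using sh.abs_S_le[OF that, of \<omega> 0] by (simp add: X.shifted_S)
    moreover have "\<bar>X.S k \<omega>\<bar> \<le> X.max_excess 0 p \<omega>" if "k \<le> p" for k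
      using X.abs_S_le[OF that, of \<omega> 0] by simp
    ultimately show "gap \<omega> (i, j) \<le> m * real n + X.S n \<omega> + X.max_excess 0 p \<omega> + 2 * sh.max_excess 0 p \<omega>
      + 4 * X.max_excess l n \<omega> + 2 * Y.max_excess l n \<omega> + 4 * l\<^sup>2 / (m * real n)"
      unfolding gap_def prod.case
      by (intro drifting_path_extent_le[OF m n l p] ij X.max_excess_nonneg Y.max_excess_nonneg X.abs_S_le Y.abs_S_le)
  qed
  then show ?thesis unfolding remainder_def by linarith
qed

text \<open>
  The pathwise bound for \<open>l = 0\<close> and \<open>p = 0\<close>, when its last term disappears, already dominates
  the remainder by square-integrable maxima.
\<close>
lemma remainder_square_integrable: "square_integrable M (remainder n)"
proof (cases "n = 0")
  case True
  then show ?thesis using X.square_integrable_const[of 0] by (simp add: remainder_0[abs_def] cong: if_cong)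
next
  case False
  interpret sh: centered_walk M "\<lambda>i. x (n - 0 + i)" by (rule X.shifted_walk)
  show ?thesis
  proof (rule square_integrable_bound)
    show "square_integrable M (\<lambda>\<omega>. X.max_excess 0 0 \<omega> + 2 * last_steps_max n 0 \<omega>
        + 4 * X.max_excess 0 n \<omega> + 2 * Y.max_excess 0 n \<omega>)"
      by (intro square_integrable_add square_integrable_cmult X.max_excess_square_integrable
          Y.max_excess_square_integrable sh.max_excess_square_integrable) auto
    show "\<bar>remainder n \<omega>\<bar> \<le> \<bar>X.max_excess 0 0 \<omega> + 2 * last_steps_max n 0 \<omega>
        + 4 * X.max_excess 0 n \<omega> + 2 * Y.max_excess 0 n \<omega>\<bar>" for \<omega>
      using remainder_le[of n 0 0 \<omega>] remainder_nonneg[of n \<omega>] False m by simp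
  qed measurable
qed

lemma remainder_second_moment_le:
  assumes n: "0 < n" and l: "0 \<le> l" "2 * l \<le> m * real n" and p: "p \<le> n" "2 * l \<le> m * real p"
  shows "X.expectation (\<lambda>\<omega>. (remainder n \<omega>)\<^sup>2) \<le> 100 * (real p * X.step_variance)
    + 80 * X.expectation (\<lambda>\<omega>. (X.max_excess l n \<omega>)\<^sup>2) + 20 * X.expectation (\<lambda>\<omega>. (Y.max_excess l n \<omega>)\<^sup>2)
    + 5 * (4 * l\<^sup>2 / (m * real n))\<^sup>2"
proof -
  interpret sh: iid_centered_walk M "\<lambda>i. x (n - p + i)" by (rule X.shifted_iid_walk)
  let ?c = "4 * l\<^sup>2 / (m * real n)"
  note int = square_integrable_power2[OF X.max_excess_square_integrable]
    square_integrable_power2[OF Y.max_excess_square_integrable]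
    square_integrable_power2[OF sh.max_excess_square_integrable]
  have "X.expectation (\<lambda>\<omega>. (remainder n \<omega>)\<^sup>2)
      \<le> X.expectation (\<lambda>\<omega>. 5 * ((X.max_excess 0 p \<omega>)\<^sup>2 + 4 * (sh.max_excess 0 p \<omega>)\<^sup>2
        + 16 * (X.max_excess l n \<omega>)\<^sup>2 + 4 * (Y.max_excess l n \<omega>)\<^sup>2 + ?c\<^sup>2))"
  proof (rule integral_mono)
    show "integrable M (\<lambda>\<omega>. (remainder n \<omega>)\<^sup>2)"
      by (rule square_integrable_power2[OF remainder_square_integrable])
    show "integrable M (\<lambda>\<omega>. 5 * ((X.max_excess 0 p \<omega>)\<^sup>2 + 4 * (sh.max_excess 0 p \<omega>)\<^sup>2
        + 16 * (X.max_excess l n \<omega>)\<^sup>2 + 4 * (Y.max_excess l n \<omega>)\<^sup>2 + ?c\<^sup>2))"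
      using l by (intro integrable_mult_right Bochner_Integration.integrable_add int X.integrable_const) auto
    fix \<omega>
    have "(remainder n \<omega>)\<^sup>2 \<le> (X.max_excess 0 p \<omega> + 2 * sh.max_excess 0 p \<omega>
        + 4 * X.max_excess l n \<omega> + 2 * Y.max_excess l n \<omega> + ?c)\<^sup>2"
      by (intro power_mono remainder_le[OF n l p] remainder_nonneg)
    also have "\<dots> \<le> 5 * ((X.max_excess 0 p \<omega>)\<^sup>2 + (2 * sh.max_excess 0 p \<omega>)\<^sup>2
        + (4 * X.max_excess l n \<omega>)\<^sup>2 + (2 * Y.max_excess l n \<omega>)\<^sup>2 + ?c\<^sup>2)"
      by (rule square_sum5_le)
    finally show "(remainder n \<omega>)\<^sup>2 \<le> 5 * ((X.max_excess 0 p \<omega>)\<^sup>2 + 4 * (sh.max_excess 0 p \<omega>)\<^sup>2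
        + 16 * (X.max_excess l n \<omega>)\<^sup>2 + 4 * (Y.max_excess l n \<omega>)\<^sup>2 + ?c\<^sup>2)"
      by (simp only: power_mult_distrib) simp
  qed
  also have "\<dots> = 5 * (X.expectation (\<lambda>\<omega>. (X.max_excess 0 p \<omega>)\<^sup>2) + 4 * X.expectation (\<lambda>\<omega>. (sh.max_excess 0 p \<omega>)\<^sup>2)
        + 16 * X.expectation (\<lambda>\<omega>. (X.max_excess l n \<omega>)\<^sup>2) + 4 * X.expectation (\<lambda>\<omega>. (Y.max_excess l n \<omega>)\<^sup>2) + ?c\<^sup>2)"
    using int l by (simp add: X.prob_space)
  also have "\<dots> \<le> 100 * (real p * X.step_variance)
    + 80 * X.expectation (\<lambda>\<omega>. (X.max_excess l n \<omega>)\<^sup>2) + 20 * X.expectation (\<lambda>\<omega>. (Y.max_excess l n \<omega>)\<^sup>2) + 5 * ?c\<^sup>2"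
    using X.expectation_max_square_le[of p] sh.expectation_max_square_le[of p]
    unfolding X.shifted_step_variance by (simp add: algebra_simps)
  finally show ?thesis .
qed

text \<open>
  With \<open>l = K \<surd>n\<close> and \<open>p\<close> about \<open>2 K \<surd>n / m\<close>, the early and late fluctuations contribute
  second moments of order \<open>p = O(\<surd>n)\<close>, and the quadratic term is bounded. The excesses
  beyond \<open>l\<close> contribute at most an arbitrarily small multiple of \<open>n\<close>, once \<open>K\<close> is large.
\<close>
lemma remainder_second_moment_small:
  "(\<lambda>n. X.expectation (\<lambda>\<omega>. (remainder n \<omega>)\<^sup>2) / real n) \<longlonglongrightarrow> 0"
proof (rule LIMSEQ_I)
  fix \<delta> :: real assume \<delta>: "0 < \<delta>"
  define e where "e = \<delta> / 200"
  have e: "0 < e" using \<delta> by (simp add: e_def)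
  obtain K1 where K1: "\<And>K. K \<ge> K1 \<Longrightarrow> \<forall>\<^sub>F n in sequentially.
      X.expectation (\<lambda>\<omega>. (X.max_excess (K * sqrt (real n)) n \<omega>)\<^sup>2) \<le> e * real n"
    using X.max_excess_small[OF e] by auto
  obtain K2 where K2: "\<And>K. K \<ge> K2 \<Longrightarrow> \<forall>\<^sub>F n in sequentially.
      X.expectation (\<lambda>\<omega>. (Y.max_excess (K * sqrt (real n)) n \<omega>)\<^sup>2) \<le> e * real n"
    using Y.max_excess_small[OF e] by auto
  define K where "K = max 0 (max K1 K2)"
  have K: "0 \<le> K" and K_ge: "K1 \<le> K" "K2 \<le> K" by (simp_all add: K_def)
  have inv: "(\<lambda>n. 1 / real n) \<longlonglongrightarrow> 0" by (rule lim_1_over_n)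
  then have inv_sqrt: "(\<lambda>n. 1 / sqrt (real n)) \<longlonglongrightarrow> 0"
    using tendsto_real_sqrt[OF inv] by (simp add: real_sqrt_divide)
  \<comment> \<open>\<open>f n\<close> bounds \<open>p / n\<close>, and \<open>g n\<close> collects all that tends to zero for fixed \<open>K\<close>.\<close>
  define f where "f n = 2 * K / m * (1 / sqrt (real n)) + 1 / real n" for n
  define g where "g n = 100 * X.step_variance * f n + 5 * (4 * K\<^sup>2 / m)\<^sup>2 * (1 / real n)" for n
  have "f \<longlonglongrightarrow> 2 * K / m * 0 + 0" unfolding f_def by (intro tendsto_intros inv inv_sqrt)
  then have f: "f \<longlonglongrightarrow> 0" by simp
  have "g \<longlonglongrightarrow> 100 * X.step_variance * 0 + 5 * (4 * K\<^sup>2 / m)\<^sup>2 * 0"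
    unfolding g_def by (intro tendsto_intros inv f)
  then have g: "g \<longlonglongrightarrow> 0" by simp
  have "\<forall>\<^sub>F n in sequentially. norm (X.expectation (\<lambda>\<omega>. (remainder n \<omega>)\<^sup>2) / real n - 0) < \<delta>"
    using K1[OF K_ge(1)] K2[OF K_ge(2)] order_tendstoD(2)[OF f zero_less_one]
      order_tendstoD(2)[OF g half_gt_zero[OF \<delta>]] eventually_gt_at_top[of 0]
  proof eventually_elim
    fix n :: nat
    assume X_small: "X.expectation (\<lambda>\<omega>. (X.max_excess (K * sqrt (real n)) n \<omega>)\<^sup>2) \<le> e * real n"
      and Y_small: "X.expectation (\<lambda>\<omega>. (Y.max_excess (K * sqrt (real n)) n \<omega>)\<^sup>2) \<le> e * real n"
      and f1: "f n < 1" and g\<delta>: "g n < \<delta> / 2" and n: "0 < n"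
    define l where "l = K * sqrt (real n)"
    define p where "p = nat \<lceil>2 * l / m\<rceil>"
    have l: "0 \<le> l" using K by (simp add: l_def)
    have fn: "f n * real n = 2 * l / m + 1"
    proof -
      have "f n * real n = 2 * K / m * (1 / sqrt (real n) * real n) + 1 / real n * real n"
        by (simp only: f_def distrib_right mult.assoc)
      then show ?thesis using n by (simp add: real_div_sqrt l_def)
    qed
    have p_le: "real p \<le> f n * real n"
      using l m unfolding fn p_def by (simp add: of_nat_nat ceiling_le_iff)
    have p_ge: "2 * l \<le> m * real p"
    proof -
      have "2 * l / m \<le> real p" unfolding p_def by linarith
      then show ?thesis using m by (simp add: field_simps)
    qed
    have "f n * real n \<le> 1 * real n" using f1 by (intro mult_right_mono) auto
    then have pn: "p \<le> n" using p_le by linarith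
    have ln: "2 * l \<le> m * real n"
    proof -
      have "m * real p \<le> m * real n" using pn m by (intro mult_left_mono) auto
      with p_ge show ?thesis by linarith
    qed
    have c: "4 * l\<^sup>2 / (m * real n) = 4 * K\<^sup>2 / m"
      using n by (simp add: l_def power_mult_distrib)
    have "X.expectation (\<lambda>\<omega>. (remainder n \<omega>)\<^sup>2)
      \<le> 100 * (f n * real n * X.step_variance) + 80 * (e * real n) + 20 * (e * real n) + 5 * (4 * K\<^sup>2 / m)\<^sup>2"
      using remainder_second_moment_le[OF n l ln pn p_ge] X_small Y_small
        mult_right_mono[OF p_le X.step_variance_nonneg]
      unfolding c l_def[symmetric] by linarith
    also have "\<dots> = (g n + 100 * e) * real n"
      using n by (simp add: g_def algebra_simps)
    finally have "X.expectation (\<lambda>\<omega>. (remainder n \<omega>)\<^sup>2) / real n \<le> g n + 100 * e"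
      using n by (simp add: pos_divide_le_eq)
    then show "norm (X.expectation (\<lambda>\<omega>. (remainder n \<omega>)\<^sup>2) / real n - 0) < \<delta>"
      using g\<delta> by (simp add: e_def)
  qed
  then show "\<exists>no. \<forall>n\<ge>no. norm (X.expectation (\<lambda>\<omega>. (remainder n \<omega>)\<^sup>2) / real n - 0) < \<delta>"
    by (simp add: eventually_sequentially)
qed

sublocale perturbed_walk M x "\<lambda>n. m * real n" remainder
  by unfold_locales (fact remainder_square_integrable remainder_second_moment_small)+

lemma D_eq_extent: "D n \<omega> = extent n \<omega>"
  by (simp add: D_def remainder_def)

end

section \<open>Variance and central limit theorem for the diameter\<close>

text \<open>
  The vector \<open>[- w$2, w$1]\<close> is \<open>w\<close> turned by a right angle, so the two form an orthonormal basis.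
\<close>
lemma norm_eq_sqrt_rotated:
  fixes w z :: "real^2"
  assumes "norm w = 1"
  shows "norm z = sqrt ((z \<bullet> w)\<^sup>2 + (z \<bullet> vector [- w$2, w$1])\<^sup>2)"
proof -
  have w: "(w$1)\<^sup>2 + (w$2)\<^sup>2 = 1"
    using assms by (simp add: norm_eq_1 inner_vec_def sum_2 power2_eq_square)
  have "(z \<bullet> w)\<^sup>2 + (z \<bullet> vector [- w$2, w$1])\<^sup>2 = ((z$1)\<^sup>2 + (z$2)\<^sup>2) * ((w$1)\<^sup>2 + (w$2)\<^sup>2)"
    by (simp add: inner_vec_def sum_2 power2_eq_square algebra_simps)
  also have "\<dots> = z \<bullet> z" using w by (simp add: inner_vec_def sum_2 power2_eq_square)
  finally show ?thesis by (simp add: norm_eq_sqrt_inner)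
qed

lemma walk_diameter_eq_Max:
  "walk_diameter Z n \<omega> = Max ((\<lambda>(i, j). norm (walk Z i \<omega> - walk Z j \<omega>)) ` ({..n} \<times> {..n}))"
  (is "_ = Max ?A")
proof (rule antisym)
  have A: "finite ?A" by simp
  show "walk_diameter Z n \<omega> \<le> Max ?A"
    unfolding walk_diameter_def
  proof (rule diameter_le)
    fix v w assume "v \<in> (\<lambda>i. walk Z i \<omega>) ` {0..n}" "w \<in> (\<lambda>i. walk Z i \<omega>) ` {0..n}"
    then obtain i j where "i \<le> n" "j \<le> n" "v = walk Z i \<omega>" "w = walk Z j \<omega>" by auto
    then show "norm (v - w) \<le> Max ?A" by (intro Max_ge[OF A]) auto
  qed simp
  show "Max ?A \<le> walk_diameter Z n \<omega>"
    unfolding walk_diameter_def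
  proof (rule Max.boundedI[OF A]; clarsimp)
    fix i j assume "i \<le> n" "j \<le> n"
    then have "dist (walk Z i \<omega>) (walk Z j \<omega>) \<le> diameter ((\<lambda>i. walk Z i \<omega>) ` {0..n})"
      by (intro diameter_bounded_bound finite_imp_bounded) auto
    then show "norm (walk Z i \<omega> - walk Z j \<omega>) \<le> diameter ((\<lambda>i. walk Z i \<omega>) ` {0..n})"
      by (simp add: dist_norm)
  qed
qed

theorem corollary1p10:
  fixes M :: "'a measure"
    and Z :: "nat \<Rightarrow> 'a \<Rightarrow> real^2"
    and \<mu> :: "real^2"
    and \<sigma>2 :: real
    and D :: "nat \<Rightarrow> 'a \<Rightarrow> real"
  defines "\<mu> \<equiv> prob_space.expectation M (Z 0)"
    and "\<sigma>2 \<equiv> drift_variance M (Z 0)"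
    and "D \<equiv> walk_diameter Z"
  assumes "prob_space M"
    and indep: "prob_space.indep_vars M (\<lambda>_. borel) Z UNIV"
    and ident: "\<And>k. distr M borel (Z k) = distr M borel (Z 0)"
    and second_moment: "integrable M (\<lambda>\<omega>. (norm (Z 0 \<omega>))\<^sup>2)"
    and drift: "\<mu> \<noteq> 0"
  shows "(\<lambda>n. prob_space.variance M (D n) / real n) \<longlonglongrightarrow> \<sigma>2
    \<and> (\<sigma>2 > 0 \<longrightarrow>
        weak_conv_m
          (\<lambda>n. distr M borel (\<lambda>\<omega>.
             (D n \<omega> - prob_space.expectation M (D n)) / sqrt (prob_space.variance M (D n))))
          std_normal_distribution
      \<and> weak_conv_m
          (\<lambda>n. distr M borel (\<lambda>\<omega>. (D n \<omega> - real n * norm \<mu>) / sqrt (real n * \<sigma>2)))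
          std_normal_distribution)"
proof -
  interpret prob_space M by fact
  have Z_meas[measurable]: "Z k \<in> borel_measurable M" for k
    using indep by (simp add: indep_vars_def2)
  have transfer_int: "integrable M (\<lambda>\<omega>. h (Z k \<omega>)) \<longleftrightarrow> integrable M (\<lambda>\<omega>. h (Z 0 \<omega>))"
    and transfer_exp: "expectation (\<lambda>\<omega>. h (Z k \<omega>)) = expectation (\<lambda>\<omega>. h (Z 0 \<omega>))"
    if [measurable]: "h \<in> borel_measurable borel" for h :: "real^2 \<Rightarrow> real" and k
    using integrable_distr_eq[of "Z k" M borel h] integrable_distr_eq[of "Z 0" M borel h]
      integral_distr[of "Z k" M borel h] integral_distr[of "Z 0" M borel h] ident[of k] by auto
  have norm_sq: "square_integrable M (\<lambda>\<omega>. norm (Z k \<omega>))" for k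
    using transfer_int[of "\<lambda>z. (norm z)\<^sup>2" k] second_moment by (simp add: square_integrable_def)
  have Z0_int: "integrable M (Z 0)"
    using square_integrable_integrable[OF norm_sq[of 0]] by (simp add: integrable_norm_iff)
  have proj: "iid_centered_walk M (\<lambda>i \<omega>. (Z (Suc i) \<omega> - \<mu>) \<bullet> w)" for w
  proof
    show "indep_vars (\<lambda>_. borel) (\<lambda>i \<omega>. (Z (Suc i) \<omega> - \<mu>) \<bullet> w) UNIV"
      by (rule indep_vars_compose2[OF indep_vars_reindex[OF indep, of Suc]]) auto
    show "square_integrable M (\<lambda>\<omega>. (Z (Suc i) \<omega> - \<mu>) \<bullet> w)" for i
    proof (rule square_integrable_bound)
      show "square_integrable M (\<lambda>\<omega>. norm w * norm (Z (Suc i) \<omega>) + norm w * norm \<mu>)"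
        by (intro square_integrable_add square_integrable_cmult norm_sq square_integrable_const)
      show "\<bar>(Z (Suc i) \<omega> - \<mu>) \<bullet> w\<bar> \<le> \<bar>norm w * norm (Z (Suc i) \<omega>) + norm w * norm \<mu>\<bar>" for \<omega>
      proof -
        have "\<bar>(Z (Suc i) \<omega> - \<mu>) \<bullet> w\<bar> \<le> norm (Z (Suc i) \<omega> - \<mu>) * norm w" by (rule Cauchy_Schwarz_ineq2)
        also have "\<dots> \<le> (norm (Z (Suc i) \<omega>) + norm \<mu>) * norm w"
          by (intro mult_right_mono norm_triangle_ineq4) auto
        finally show ?thesis by (simp add: algebra_simps)
      qed
    qed measurable
    show "expectation (\<lambda>\<omega>. (Z (Suc i) \<omega> - \<mu>) \<bullet> w) = 0" for i
    proof -
      have "expectation (\<lambda>\<omega>. (Z (Suc i) \<omega> - \<mu>) \<bullet> w) = expectation (\<lambda>\<omega>. (Z 0 \<omega> - \<mu>) \<bullet> w)"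
        by (rule transfer_exp) measurable
      also have "\<dots> = expectation (\<lambda>\<omega>. Z 0 \<omega> - \<mu>) \<bullet> w"
        using Z0_int by (intro integral_inner_left) auto
      also have "expectation (\<lambda>\<omega>. Z 0 \<omega> - \<mu>) = 0"
        using Z0_int by (simp add: prob_space \<mu>_def)
      finally show ?thesis by simp
    qed
    show "distr M borel (\<lambda>\<omega>. (Z (Suc i) \<omega> - \<mu>) \<bullet> w) = distr M borel (\<lambda>\<omega>. (Z (Suc 0) \<omega> - \<mu>) \<bullet> w)" for i
    proof -
      have "distr M borel (\<lambda>\<omega>. (Z k \<omega> - \<mu>) \<bullet> w) = distr (distr M borel (Z k)) borel (\<lambda>z. (z - \<mu>) \<bullet> w)" for k
        by (subst distr_distr) (auto simp: comp_def)
      then show ?thesis using ident by metis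
    qed
  qed
  define \<mu>hat where "\<mu>hat = \<mu> /\<^sub>R norm \<mu>"
  define e :: "real^2" where "e = vector [- \<mu>hat$2, \<mu>hat$1]"
  have hat: "norm \<mu>hat = 1" "\<mu> \<bullet> \<mu>hat = norm \<mu>"
    using drift by (simp_all add: \<mu>hat_def dot_square_norm power2_eq_square)
  have "\<mu> = norm \<mu> *\<^sub>R \<mu>hat" using drift by (simp add: \<mu>hat_def)
  moreover have "\<mu>hat \<bullet> e = 0" by (simp add: e_def inner_vec_def sum_2)
  ultimately have \<mu>e: "\<mu> \<bullet> e = 0" by (metis inner_scaleR_left mult_zero_right)
  define x where "x i \<omega> = (Z (Suc i) \<omega> - \<mu>) \<bullet> \<mu>hat" for i \<omega>
  define y where "y i \<omega> = (Z (Suc i) \<omega> - \<mu>) \<bullet> e" for i \<omega>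
  interpret X: iid_centered_walk M x unfolding x_def by (rule proj)
  interpret Y: iid_centered_walk M y unfolding y_def by (rule proj)
  interpret P: drifting_planar_walk M x y "norm \<mu>"
    by unfold_locales (use drift in simp)
  have sum_proj: "walk Z k \<omega> \<bullet> w = real k * (\<mu> \<bullet> w) + (\<Sum>i<k. (Z (Suc i) \<omega> - \<mu>) \<bullet> w)" for k \<omega> w
    by (simp add: walk_def inner_sum_left inner_diff_left sum_subtractf sum.atLeast1_atMost_eq)
  have "norm (walk Z i \<omega> - walk Z j \<omega>) = P.gap \<omega> (i, j)" for i j \<omega>
    using norm_eq_sqrt_rotated[OF hat(1), of "walk Z i \<omega> - walk Z j \<omega>"]
    unfolding e_def[symmetric] inner_diff_left
    by (simp add: P.gap_def sum_proj hat \<mu>e X.S_def Y.S_def x_def[symmetric] y_def[symmetric] mult.commute)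
  then have D_eq: "D n = P.D n" for n
    by (intro ext) (simp add: D_def walk_diameter_eq_Max P.D_eq_extent P.extent_def case_prod_unfold)
  have "\<sigma>2 = expectation (\<lambda>\<omega>. ((Z 0 \<omega> - \<mu>) \<bullet> \<mu>hat)\<^sup>2)"
    by (simp add: \<sigma>2_def drift_variance_def Let_def \<mu>_def \<mu>hat_def)
  also have "\<dots> = X.step_variance"
    unfolding X.step_variance_def x_def by (rule transfer_exp[symmetric]) measurable
  finally show ?thesis
    using P.variance_limit P.clt_self_normalised P.clt_deterministic_centring
    by (simp add: D_eq mult.commute)
qed

end
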